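(* Let $\lambda:\mathbb{N}^n\to\mathbb{R}$ be a map and let $T$ be the corresponding diagonal linear operator, defined by $T(z^\alpha)=\lambda(\alpha)z^\alpha$ for all $\alpha\in\mathbb{N}^n$. Then $T\in\mathcal{A}_n(\mathbb{R})$ if and only if $T$ has a symbol $F_T(z,w)$ of the form $$F_T(z,w)=f_1(z_1w_1)f_2(z_2w_2)\cdots f_n(z_nw_n),$$ where, for each $1\le i\le n$, $f_i(t)$ is a polynomial with only real and nonpositive zeros.
   Context: A polynomial $f\in\mathbb{R}[z_1,\ldots,z_n]$ is real stable if $f(z_1,\ldots,z_n)\neq 0$ whenever $\operatorname{Im}(z_j)>0$ for all $1\le j\le n$; $\mathcal{H}_n(\mathbb{R})$ denotes the set of real stable polynomials in $n$ variables. $\mathcal{A}_n[\mathbb{R}]$ is the set of finite order linear differential operators $T=\sum_{\alpha,\beta\in\mathbb{N}^n}a_{\alpha\beta}z^\alpha\partial^\beta$ (finite sum, $\partial_i=\partial/\partial z_i$, multi-index notation) with $a_{\alpha\beta}\in\mathbb{R}$; the symbol of such $T$ is the polynomial $F_T(z,w)=\sum_{\alpha,\beta}a_{\alpha\beta}z^\alpha w^\beta$. $\mathcal{A}_n(\mathbb{R})$ is the set of nonzero $T\in\mathcal{A}_n[\mathbb{R}]$ with $T(\mathcal{H}_n(\mathbb{R}))\subseteq\mathcal{H}_n(\mathbb{R})\cup\{0\}$. The zero polynomial is not regarded as a polynomial with only real and nonpositive zeros; nonzero constants are. *)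

theory Defs
  imports "HOL-Complex_Analysis.Complex_Analysis"
    "HOL-Computational_Algebra.Computational_Algebra"
    "HOL-Library.Poly_Mapping"
begin

text \<open>
  Real polynomials in variables indexed by \<open>'k\<close>: finitely supported maps from multi-indices
  to coefficients, with the convolution product of \<open>Poly_Mapping\<close>.  For a finite type \<open>'n\<close>
  with \<open>n\<close> elements, \<open>'n midx\<close> is the set of all multi-indices of length \<open>n\<close>.
\<close>

type_synonym 'k midx = "'k \<Rightarrow>\<^sub>0 nat"
type_synonym 'k mpoly = "'k midx \<Rightarrow>\<^sub>0 real"

definition mvar :: "'k \<Rightarrow> 'k mpoly"
  where "mvar i = Poly_Mapping.single (Poly_Mapping.single i 1) 1"

definition mconst :: "real \<Rightarrow> 'k mpoly"
  where "mconst c = Poly_Mapping.single 0 c"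

definition meval :: "'k::finite mpoly \<Rightarrow> ('k \<Rightarrow> complex) \<Rightarrow> complex"
  where "meval p z =
    (\<Sum>\<alpha>\<in>Poly_Mapping.keys p.
       of_real (Poly_Mapping.lookup p \<alpha>) * (\<Prod>i\<in>UNIV. z i ^ Poly_Mapping.lookup \<alpha> i))"

definition real_stable :: "'k::finite mpoly \<Rightarrow> bool"
  where "real_stable p \<longleftrightarrow> (\<forall>z. (\<forall>i. Im (z i) > 0) \<longrightarrow> meval p z \<noteq> 0)"

lift_definition pderivative :: "'k \<Rightarrow> 'k mpoly \<Rightarrow> 'k mpoly"
  is "\<lambda>i p \<alpha>. real (Poly_Mapping.lookup \<alpha> i + 1) * p (\<alpha> + Poly_Mapping.single i 1)"
proof -
  fix i :: 'k and p :: "'k midx \<Rightarrow> real"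
  assume fin: "finite {x. p x \<noteq> 0}"
  have "finite ((\<lambda>\<alpha>. \<alpha> + Poly_Mapping.single i (1::nat)) -` {x. p x \<noteq> 0})"
    by (rule finite_vimageI[OF fin]) (simp add: inj_on_def)
  then show "finite {\<alpha>. real (Poly_Mapping.lookup \<alpha> i + 1) * p (\<alpha> + Poly_Mapping.single i 1) \<noteq> 0}"
    by (rule rev_finite_subset) auto
qed

lemma pderivative_single:
  "pderivative i (Poly_Mapping.single \<alpha> c) =
     Poly_Mapping.single (\<alpha> - Poly_Mapping.single i 1) (real (Poly_Mapping.lookup \<alpha> i) * c)"
proof (rule poly_mapping_eqI)
  fix \<beta> :: "'a midx"
  have *: "\<alpha> - Poly_Mapping.single i 1 = \<beta> \<longleftrightarrow> \<alpha> = \<beta> + Poly_Mapping.single i 1"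
    if "Poly_Mapping.lookup \<alpha> i \<noteq> 0"
    using that
    by (auto simp: poly_mapping_eq_iff fun_eq_iff lookup_add lookup_minus lookup_single when_def)
  show "Poly_Mapping.lookup (pderivative i (Poly_Mapping.single \<alpha> c)) \<beta> =
    Poly_Mapping.lookup (Poly_Mapping.single (\<alpha> - Poly_Mapping.single i 1)
      (real (Poly_Mapping.lookup \<alpha> i) * c)) \<beta>"
  proof (cases "Poly_Mapping.lookup \<alpha> i = 0")
    case True
    then have "\<alpha> \<noteq> \<beta> + Poly_Mapping.single i 1"
      by (auto simp: lookup_add)
    with True show ?thesis
      by (simp add: pderivative.rep_eq lookup_single when_def)
  next
    case False
    then show ?thesis
      using * by (auto simp: pderivative.rep_eq lookup_single when_def lookup_add)
  qed
qed

lemma pderivative_commute: "pderivative i (pderivative j p) = pderivative j (pderivative i p)"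
  by (rule poly_mapping_eqI)
     (auto simp: pderivative.rep_eq lookup_add lookup_single when_def add_ac)

definition mderivative :: "'k::finite midx \<Rightarrow> 'k mpoly \<Rightarrow> 'k mpoly"
  where "mderivative \<beta> p =
    Finite_Set.fold (\<lambda>i. pderivative i ^^ Poly_Mapping.lookup \<beta> i) p UNIV"

text \<open>The fold is independent of the order in which the factors are composed:\<close>

lemma comp_fun_commute_pderivative: "comp_fun_commute (\<lambda>i. pderivative i ^^ e i)"
proof -
  interpret comp_fun_commute pderivative
    by standard (auto simp: fun_eq_iff pderivative_commute)
  show ?thesis by (rule comp_fun_commute_funpow)
qed

text \<open>
  A polynomial \<open>F\<close> in the variables \<open>z\<^sub>i\<close> (index \<open>Inl i\<close>) and \<open>w\<^sub>i\<close> (index \<open>Inr i\<close>)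
  encodes the coefficient family of a differential operator:
  the coefficient of \<open>F\<close> at \<open>z\<^sup>\<alpha> w\<^sup>\<beta>\<close> is the coefficient in front of \<open>z\<^sup>\<alpha> \<partial>\<^sup>\<beta>\<close>.
\<close>

definition diff_op :: "('n::finite + 'n) mpoly \<Rightarrow> 'n mpoly \<Rightarrow> 'n mpoly"
  where "diff_op F p =
    (\<Sum>\<gamma>\<in>Poly_Mapping.keys F.
       Poly_Mapping.single (Poly_Mapping.map_key Inl \<gamma>) (Poly_Mapping.lookup F \<gamma>)
         * mderivative (Poly_Mapping.map_key Inr \<gamma>) p)"

definition is_symbol :: "('n::finite mpoly \<Rightarrow> 'n mpoly) \<Rightarrow> ('n + 'n) mpoly \<Rightarrow> bool"
  where "is_symbol T F \<longleftrightarrow> T = diff_op F"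

definition diff_ops :: "('n::finite mpoly \<Rightarrow> 'n mpoly) set"
  where "diff_ops = {T. \<exists>F. is_symbol T F}"

definition stability_preserving_diff_ops :: "('n::finite mpoly \<Rightarrow> 'n mpoly) set"
  where "stability_preserving_diff_ops =
    {T \<in> diff_ops. T \<noteq> (\<lambda>p. 0) \<and> T ` {p. real_stable p} \<subseteq> {p. real_stable p} \<union> {0}}"

definition diagonal_op :: "('k midx \<Rightarrow> real) \<Rightarrow> 'k mpoly \<Rightarrow> 'k mpoly"
  where "diagonal_op l p =
    (\<Sum>\<alpha>\<in>Poly_Mapping.keys p. Poly_Mapping.single \<alpha> (l \<alpha> * Poly_Mapping.lookup p \<alpha>))"

lemma lookup_diagonal_op:
  "Poly_Mapping.lookup (diagonal_op l p) \<alpha> = l \<alpha> * Poly_Mapping.lookup p \<alpha>"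
proof -
  have "Poly_Mapping.lookup (diagonal_op l p) \<alpha> =
    (\<Sum>\<beta>\<in>Poly_Mapping.keys p. if \<beta> = \<alpha> then l \<beta> * Poly_Mapping.lookup p \<beta> else 0)"
    by (simp add: diagonal_op_def lookup_sum lookup_single when_def)
  also have "\<dots> = l \<alpha> * Poly_Mapping.lookup p \<alpha>"
    by (simp add: in_keys_iff)
  finally show ?thesis .
qed

lemma diagonal_op_monomial:
  "diagonal_op l (Poly_Mapping.single \<alpha> 1) = mconst (l \<alpha>) * Poly_Mapping.single \<alpha> 1"
  by (rule poly_mapping_eqI)
     (simp add: lookup_diagonal_op mconst_def mult_single lookup_single when_def)

lemma diagonal_op_add: "diagonal_op l (p + q) = diagonal_op l p + diagonal_op l q"
  by (rule poly_mapping_eqI) (simp add: lookup_diagonal_op lookup_add distrib_left)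

lemma diagonal_op_scale: "diagonal_op l (mconst c * p) = mconst c * diagonal_op l p"
proof -
  have "Poly_Mapping.lookup (mconst c * q) \<alpha> = c * Poly_Mapping.lookup q \<alpha>" for q :: "'a mpoly" and \<alpha>
    unfolding mconst_def mult_map_scale_conv_mult[symmetric]
    by (simp add: Poly_Mapping.map.rep_eq when_def)
  then show ?thesis
    by (intro poly_mapping_eqI) (simp add: lookup_diagonal_op)
qed

text \<open>The zeros are the complex ones; the zero polynomial is excluded, nonzero constants are not.\<close>

definition only_real_nonpos_zeros :: "real poly \<Rightarrow> bool"
  where "only_real_nonpos_zeros f \<longleftrightarrow>
    f \<noteq> 0 \<and> (\<forall>x::complex. poly (map_poly of_real f) x = 0 \<longrightarrow> x \<in> \<real> \<and> Re x \<le> 0)"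

definition msubst :: "real poly \<Rightarrow> 'k mpoly \<Rightarrow> 'k mpoly"
  where "msubst f q = poly (map_poly mconst f) q"

end

theory Submission
  imports Defs
begin


text \<open>
  The operator with symbol \<open>\<Prod>\<^sub>i f\<^sub>i(z\<^sub>i w\<^sub>i)\<close> is diagonal with eigenvalue \<open>\<Prod>\<^sub>i \<lambda>\<^sub>i(\<alpha>\<^sub>i)\<close>, where
  \<open>\<lambda>\<^sub>i(k) = \<Sum>\<^sub>m c\<^sub>m k(k - 1)\<dots>(k - m + 1)\<close> for \<open>f\<^sub>i = \<Sum>\<^sub>m c\<^sub>m t\<^sup>m\<close>.

  Sufficiency.  One may treat one variable at a time and write \<open>f = t\<^sup>m g\<close> with all zeros of \<open>g\<close>
  negative.  Partial derivatives preserve stability, and for \<open>r > 0\<close> and a parameter \<open>x\<close> in the upper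
  half plane, \<open>x \<partial> + r\<close> preserves nonvanishing on the upper half plane, since \<open>Im (P'/P) \<le> 0\<close> while
  \<open>Im (- r/x) > 0\<close>.

  Necessity.  Testing on \<open>z\<^sup>\<alpha> (1 \<plusminus> z\<^sub>i)(1 + z\<^sub>j)\<close> gives
  \<open>\<lambda>(\<alpha>) \<lambda>(\<alpha> + e\<^sub>i + e\<^sub>j) = \<lambda>(\<alpha> + e\<^sub>i) \<lambda>(\<alpha> + e\<^sub>j)\<close>.  The restriction of \<open>\<lambda>\<close> to a line is a polynomial
  multiplier sequence; it has no zero after a nonzero value and has constant sign.  So \<open>\<lambda>\<close> has no
  zero on some orthant, where it therefore factors, and by polynomiality it factors everywhere.  The
  zeros of each factor are located by applying the multiplier to \<open>(1 + z)\<^sup>N\<close> and letting \<open>N\<close> tend to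
  infinity.
\<close>

section \<open>Symbols of diagonal operators\<close>

abbreviation lookup :: "('a \<Rightarrow>\<^sub>0 'b::zero) \<Rightarrow> 'a \<Rightarrow> 'b"
  where "lookup \<equiv> Poly_Mapping.lookup"

abbreviation single :: "'a \<Rightarrow> 'b::zero \<Rightarrow> 'a \<Rightarrow>\<^sub>0 'b"
  where "single \<equiv> Poly_Mapping.single"

abbreviation keys :: "('a \<Rightarrow>\<^sub>0 'b::zero) \<Rightarrow> 'a set"
  where "keys \<equiv> Poly_Mapping.keys"

text \<open>The falling factorial \<open>k (k - 1) ... (k - m + 1)\<close>, the eigenvalue of
  \<open>z^m \<partial>^m\<close> on \<open>z^k\<close>. The binomial form makes it vanish for
  \<open>k < m\<close>, that is, on monomials killed by the differentiation.\<close>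

definition falling :: "nat \<Rightarrow> nat \<Rightarrow> real"
  where "falling m k = fact m * real (k choose m)"

text \<open>The eigenvalue on \<open>z\<^sup>k\<close> of the univariate operator with symbol \<open>f(z w)\<close>.\<close>

definition ffval :: "real poly \<Rightarrow> nat \<Rightarrow> real"
  where "ffval f k = (\<Sum>m\<le>degree f. coeff f m * falling m k)"

lemma falling_0 [simp]: "falling 0 k = 1"
  by (simp add: falling_def)

lemma falling_eq_0_iff: "falling m k = 0 \<longleftrightarrow> k < m"
  by (simp add: falling_def)

lemma falling_Suc': "falling (Suc m) k = real k * falling m (k - 1)"
proof (cases k)
  case (Suc n)
  have "Suc m * (Suc n choose Suc m) = Suc n * (n choose m)"
    by (rule Suc_times_binomial_eq[symmetric, unfolded mult.commute[of "_ choose _"]])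
  then have "real (Suc m) * real (Suc n choose Suc m) = real (Suc n) * real (n choose m)"
    by (metis of_nat_mult)
  then show ?thesis
    unfolding falling_def Suc fact_Suc diff_Suc_1 by (simp only: mult_ac of_nat_mult)
qed (simp add: falling_def)

lemma falling_Suc: "falling (Suc m) k = real (k - m) * falling m k"
proof -
  have "real (k - m) * real (k choose m) = real k * real ((k - 1) choose m)"
    by (metis binomial_absorb_comp of_nat_mult)
  then have "real k * falling m (k - 1) = real (k - m) * falling m k"
    by (simp add: falling_def mult_ac)
  then show ?thesis
    by (simp only: falling_Suc')
qed

lemma sum_coeff_extend:
  fixes f :: "'a::comm_ring_1 poly"
  assumes "degree f \<le> N"
  shows "(\<Sum>m\<le>degree f. coeff f m * c m) = (\<Sum>m\<le>N. coeff f m * c m)"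
  by (rule sum.mono_neutral_left) (use assms in \<open>auto simp: coeff_eq_0 not_le\<close>)

lemma ffval_bound: "degree f \<le> N \<Longrightarrow> ffval f k = (\<Sum>m\<le>N. coeff f m * falling m k)"
  unfolding ffval_def by (rule sum_coeff_extend)

section \<open>Action of differential operators on monomials\<close>

lemma poly_mapping_sum_single:
  fixes p :: "'a \<Rightarrow>\<^sub>0 'b::comm_monoid_add"
  shows "p = (\<Sum>\<alpha>\<in>keys p. single \<alpha> (lookup p \<alpha>))"
  by (rule poly_mapping_eqI) (simp add: lookup_sum lookup_single when_def in_keys_iff)

text \<open>Terms may be added at exponents already present; the identities proved this way are
  additive in the polynomial, so this simple form suffices.\<close>

lemma poly_mapping_add_induct [case_names zero add]:
  fixes p :: "'a \<Rightarrow>\<^sub>0 'b::comm_monoid_add"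
  assumes "P 0" "\<And>p \<alpha> c. P p \<Longrightarrow> P (p + single \<alpha> c)"
  shows "P p"
proof -
  have "P (\<Sum>\<alpha>\<in>A. single \<alpha> (lookup p \<alpha>))" if "finite A" for A
    using that
  proof (induction A rule: finite_induct)
    case (insert x F)
    then show ?case
      using assms(2)[of "\<Sum>\<alpha>\<in>F. single \<alpha> (lookup p \<alpha>)" x "lookup p x"] by (simp add: add.commute)
  qed (simp add: assms)
  from this[of "keys p"] show ?thesis
    using poly_mapping_sum_single[of p] by simp
qed

lemma pderivative_0 [simp]: "pderivative i 0 = 0"
  by (rule poly_mapping_eqI) (simp add: pderivative.rep_eq)

lemma pderivative_add: "pderivative i (p + q) = pderivative i p + pderivative i q"
  by (rule poly_mapping_eqI) (simp add: pderivative.rep_eq lookup_add algebra_simps)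

lemma higher_pderivative_0 [simp]: "(pderivative i ^^ m) 0 = 0"
  by (induction m) auto

lemma higher_pderivative_add:
  "(pderivative i ^^ m) (p + q) = (pderivative i ^^ m) p + (pderivative i ^^ m) q"
  by (induction m) (auto simp: pderivative_add)

lemma higher_pderivative_single:
  "(pderivative i ^^ m) (single \<alpha> c) =
     single (\<alpha> - single i m) (falling m (lookup \<alpha> i) * c)"
proof (induction m)
  case (Suc m)
  have "\<alpha> - single i m - single i 1 = \<alpha> - single i (Suc m)"
    by (rule poly_mapping_eqI) (simp add: lookup_minus lookup_single when_def)
  then show ?case
    using Suc by (simp add: pderivative_single lookup_minus falling_Suc mult_ac)
qed simp

lemma mderivative_add: "mderivative \<beta> (p + q) = mderivative \<beta> p + mderivative \<beta> q"
proof -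
  interpret comp_fun_commute "\<lambda>i. pderivative i ^^ lookup \<beta> i"
    by (rule comp_fun_commute_pderivative)
  have "Finite_Set.fold (\<lambda>i. pderivative i ^^ lookup \<beta> i) (p + q) S =
    Finite_Set.fold (\<lambda>i. pderivative i ^^ lookup \<beta> i) p S +
    Finite_Set.fold (\<lambda>i. pderivative i ^^ lookup \<beta> i) q S" if "finite S" for S
    using that by (induction S rule: finite_induct) (simp_all add: higher_pderivative_add)
  then show ?thesis
    by (simp add: mderivative_def)
qed

lemma mderivative_0 [simp]: "mderivative \<beta> 0 = 0"
  using mderivative_add[of \<beta> 0 0] by simp

lemma midx_sum_single: "(\<Sum>i\<in>UNIV. single i (lookup \<beta> i)) = (\<beta> :: 'n::finite midx)"
  by (rule poly_mapping_eqI) (simp add: lookup_sum lookup_single when_def)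

text \<open>The derivatives act on different coordinates, so their factors multiply. If \<beta>
  exceeds \<alpha> in some coordinate, the exponent is truncated, but then a falling factorial is
  zero.\<close>

lemma mderivative_single:
  "mderivative \<beta> (single \<alpha> c) =
     single (\<alpha> - \<beta>) ((\<Prod>i\<in>UNIV. falling (lookup \<beta> i) (lookup \<alpha> i)) * c)"
proof -
  interpret comp_fun_commute "\<lambda>i. pderivative i ^^ lookup \<beta> i"
    by (rule comp_fun_commute_pderivative)
  have "Finite_Set.fold (\<lambda>i. pderivative i ^^ lookup \<beta> i) (single \<alpha> c) S =
    single (\<alpha> - (\<Sum>i\<in>S. single i (lookup \<beta> i)))
      ((\<Prod>i\<in>S. falling (lookup \<beta> i) (lookup \<alpha> i)) * c)" if "finite S" for S
    using that
  proof (induction S rule: finite_induct)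
    case (insert j S)
    have "lookup (\<Sum>i\<in>S. single i (lookup \<beta> i)) j = 0"
      using insert.hyps by (auto simp: lookup_sum lookup_single when_def)
    then show ?case
      using insert by (simp add: higher_pderivative_single lookup_minus diff_diff_add add.commute mult_ac)
  qed simp
  from this[of UNIV] show ?thesis
    by (simp add: mderivative_def midx_sum_single)
qed

lemma diff_op_superset:
  assumes "finite A" "keys F \<subseteq> A"
  shows "diff_op F p = (\<Sum>\<gamma>\<in>A. single (Poly_Mapping.map_key Inl \<gamma>) (lookup F \<gamma>)
           * mderivative (Poly_Mapping.map_key Inr \<gamma>) p)"
  unfolding diff_op_def
  by (rule sum.mono_neutral_left) (use assms in \<open>auto simp: in_keys_iff\<close>)

lemma diff_op_symbol_add: "diff_op (F + G) p = diff_op F p + diff_op G p"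
proof -
  let ?A = "keys F \<union> keys G"
  have "keys (F + G) \<subseteq> ?A" by (rule Poly_Mapping.keys_add)
  then show ?thesis
    using diff_op_superset[of ?A "F + G" p] diff_op_superset[of ?A F p] diff_op_superset[of ?A G p]
    by (simp add: lookup_add single_add distrib_right sum.distrib)
qed

lemma diff_op_symbol_0 [simp]: "diff_op 0 p = 0"
  by (simp add: diff_op_def)

lemma diff_op_symbol_sum: "diff_op (\<Sum>x\<in>A. F x) p = (\<Sum>x\<in>A. diff_op (F x) p)"
  by (induction A rule: infinite_finite_induct) (auto simp: diff_op_symbol_add)

lemma diff_op_symbol_single:
  "diff_op (single \<gamma> c) p =
     single (Poly_Mapping.map_key Inl \<gamma>) c * mderivative (Poly_Mapping.map_key Inr \<gamma>) p"
  using diff_op_superset[of "{\<gamma>}" "single \<gamma> c" p] by simp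

lemma diff_op_0 [simp]: "diff_op F 0 = 0"
  by (simp add: diff_op_def)

lemma diff_op_add: "diff_op F (p + q) = diff_op F p + diff_op F q"
  by (simp add: diff_op_def mderivative_add distrib_left sum.distrib)

lemma diagonal_op_0 [simp]: "diagonal_op l 0 = 0"
  by (simp add: diagonal_op_def)

lemma diagonal_op_single: "diagonal_op l (single \<alpha> c) = single \<alpha> (l \<alpha> * c)"
  by (rule poly_mapping_eqI) (simp add: lookup_diagonal_op lookup_single when_def)

lemma diagonal_op_eq_diff_opI:
  assumes "\<And>\<alpha> c. diff_op F (single \<alpha> c) = single \<alpha> (l \<alpha> * c)"
  shows "diagonal_op l = diff_op F"
proof
  fix p show "diagonal_op l p = diff_op F p"
    by (induction p rule: poly_mapping_add_induct)
       (simp_all add: diagonal_op_add diff_op_add assms diagonal_op_single)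
qed

lemma lookup_map_key_Inl: "lookup (Poly_Mapping.map_key Inl \<gamma>) i = lookup \<gamma> (Inl i)"
  by (simp add: map_key.rep_eq)

lemma lookup_map_key_Inr: "lookup (Poly_Mapping.map_key Inr \<gamma>) i = lookup \<gamma> (Inr i)"
  by (simp add: map_key.rep_eq)

lemma prod_single:
  "finite A \<Longrightarrow> (\<Prod>x\<in>A. single (g x) (c x :: real)) = single (\<Sum>x\<in>A. g x) (\<Prod>x\<in>A. c x)"
  by (induction A rule: finite_induct) (auto simp: mult_single)

lemma single_power: "single a (c :: real) ^ k = single (\<Sum>i<k. a) (c ^ k)"
  by (induction k) (auto simp: mult_single add.commute)

lemma lookup_sum_const: "lookup (\<Sum>i<k. a) x = (k * lookup a x :: nat)"
  by (simp add: lookup_sum)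

lemma msubst_Inl_Inr:
  "msubst f (mvar (Inl i) * mvar (Inr i)) =
     (\<Sum>m\<le>degree f. single (single (Inl i) m + single (Inr i) m) (coeff f m))"
proof -
  have inj: "inj mconst"
    by (rule injI) (metis lookup_single_eq mconst_def)
  have [simp]: "mconst 0 = (0 :: 'k mpoly)" by (simp add: mconst_def)
  have deg: "degree (map_poly mconst f) = degree f"
    by (rule degree_map_poly) (metis inj \<open>mconst 0 = 0\<close> injD)
  have 1: "(mvar (Inl i) * mvar (Inr i)) ^ m = single (single (Inl i) m + single (Inr i) m) (1::real)" for m
    unfolding mvar_def mult_single single_power
    by (intro arg_cong2[where f = single] poly_mapping_eqI)
       (auto simp: lookup_sum_const lookup_add lookup_single when_def)
  show ?thesis
    unfolding msubst_def poly_altdef deg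
    by (rule sum.cong) (simp_all add: coeff_map_poly 1, simp add: mconst_def mult_single)
qed

text \<open>Multiplying out over all choices \<open>s\<close> of exponents gives monomials in the
  products \<open>z_i w_i\<close>. Each acts on a monomial by falling factorials, and distributivity
  reassembles the factors \<open>ffval\<close>.\<close>

lemma diff_op_prod_msubst:
  fixes f :: "'n::finite \<Rightarrow> real poly"
  shows "diff_op (\<Prod>i\<in>UNIV. msubst (f i) (mvar (Inl i) * mvar (Inr i))) (single \<alpha> c) =
    single \<alpha> ((\<Prod>i\<in>UNIV. ffval (f i) (lookup \<alpha> i)) * c)"
proof -
  let ?e = "\<lambda>i m. single (Inl i) m + single (Inr i) m :: ('n + 'n) midx"
  let ?P = "PiE UNIV (\<lambda>i. {..degree (f i)})"
  have step: "diff_op (single (\<Sum>i\<in>UNIV. ?e i (s i)) d) (single \<alpha> c) =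
      single \<alpha> (d * (\<Prod>i\<in>UNIV. falling (s i) (lookup \<alpha> i)) * c)" for s d
  proof (cases "\<forall>i. s i \<le> lookup \<alpha> i")
    case True
    let ?g = "\<Sum>i\<in>UNIV. ?e i (s i)"
    have "Poly_Mapping.map_key Inl ?g + (\<alpha> - Poly_Mapping.map_key Inr ?g) = \<alpha>"
      by (rule poly_mapping_eqI) (use True in
        \<open>simp add: lookup_add lookup_minus lookup_map_key_Inl lookup_map_key_Inr lookup_sum lookup_single when_def\<close>)
    moreover have "lookup (Poly_Mapping.map_key Inr ?g) i = s i" for i
      by (simp add: lookup_map_key_Inr lookup_sum lookup_add lookup_single when_def)
    ultimately show ?thesis
      by (simp add: diff_op_symbol_single mderivative_single mult_single mult_ac)
  next
    case False
    let ?g = "\<Sum>i\<in>UNIV. ?e i (s i)"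
    have *: "lookup (Poly_Mapping.map_key Inr ?g) i = s i" for i
      by (simp add: lookup_map_key_Inr lookup_sum lookup_add lookup_single when_def)
    from False obtain i where "falling (s i) (lookup \<alpha> i) = 0"
      by (auto simp: falling_eq_0_iff not_le)
    then have P0: "(\<Prod>i\<in>UNIV. falling (s i) (lookup \<alpha> i)) = 0"
      by auto
    show ?thesis
      by (simp add: diff_op_symbol_single mderivative_single mult_single * P0)
  qed
  have "(\<Prod>i\<in>UNIV. msubst (f i) (mvar (Inl i) * mvar (Inr i))) =
      (\<Sum>s\<in>?P. single (\<Sum>i\<in>UNIV. ?e i (s i)) (\<Prod>i\<in>UNIV. coeff (f i) (s i)))"
    by (simp add: msubst_Inl_Inr prod_sum_PiE prod_single)
  then have "diff_op (\<Prod>i\<in>UNIV. msubst (f i) (mvar (Inl i) * mvar (Inr i))) (single \<alpha> c) =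
      (\<Sum>s\<in>?P. single \<alpha> ((\<Prod>i\<in>UNIV. coeff (f i) (s i)) * (\<Prod>i\<in>UNIV. falling (s i) (lookup \<alpha> i)) * c))"
    by (simp add: diff_op_symbol_sum step)
  also have "\<dots> = single \<alpha> (\<Sum>s\<in>?P. (\<Prod>i\<in>UNIV. coeff (f i) (s i) * falling (s i) (lookup \<alpha> i)) * c)"
    by (rule poly_mapping_eqI) (simp add: lookup_sum lookup_single when_def prod.distrib)
  also have "(\<Sum>s\<in>?P. (\<Prod>i\<in>UNIV. coeff (f i) (s i) * falling (s i) (lookup \<alpha> i)) * c) =
      (\<Prod>i\<in>UNIV. ffval (f i) (lookup \<alpha> i)) * c"
    by (simp add: ffval_def prod_sum_PiE sum_distrib_right)
  finally show ?thesis .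
qed

text \<open>This replaces the symbol condition of the theorem by a product formula for the
  eigenvalues.\<close>

lemma is_symbol_prod_msubst_iff:
  fixes f :: "'n::finite \<Rightarrow> real poly"
  shows "is_symbol (diagonal_op l) (\<Prod>i\<in>UNIV. msubst (f i) (mvar (Inl i) * mvar (Inr i))) \<longleftrightarrow>
    (\<forall>\<alpha>. l \<alpha> = (\<Prod>i\<in>UNIV. ffval (f i) (lookup \<alpha> i)))" (is "?L \<longleftrightarrow> ?R")
proof
  assume ?L
  show ?R
  proof
    fix \<alpha>
    have "single \<alpha> (l \<alpha> * 1) = single \<alpha> ((\<Prod>i\<in>UNIV. ffval (f i) (lookup \<alpha> i)) * 1)"
      using \<open>?L\<close> diff_op_prod_msubst[of f \<alpha> 1] diagonal_op_single[of l \<alpha> 1]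
      by (simp add: is_symbol_def)
    then show "l \<alpha> = (\<Prod>i\<in>UNIV. ffval (f i) (lookup \<alpha> i))"
      by (metis lookup_single_eq mult.right_neutral)
  qed
next
  assume ?R
  then show ?L
    unfolding is_symbol_def by (intro diagonal_op_eq_diff_opI) (simp add: diff_op_prod_msubst)
qed

text \<open>Reading off the coefficient of \<open>z^\<alpha>\<close> in the image of
  \<open>z^\<alpha>\<close> keeps only those terms of the symbol whose exponents in \<open>z\<close>
  and \<open>w\<close> agree.\<close>

lemma diagonal_diff_op_coeff:
  fixes l :: "'n::finite midx \<Rightarrow> real"
  assumes "diagonal_op l = diff_op F"
  shows "l \<alpha> = (\<Sum>\<gamma>\<in>keys F. if \<forall>i. lookup \<gamma> (Inl i) = lookup \<gamma> (Inr i)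
     then lookup F \<gamma> * (\<Prod>i\<in>UNIV. falling (lookup \<gamma> (Inr i)) (lookup \<alpha> i)) else 0)"
proof -
  have "l \<alpha> = lookup (diff_op F (single \<alpha> 1)) \<alpha>"
    using assms diagonal_op_single[of l \<alpha> 1] by (metis lookup_single_eq mult.right_neutral)
  also have "\<dots> = (\<Sum>\<gamma>\<in>keys F. lookup (single (Poly_Mapping.map_key Inl \<gamma>) (lookup F \<gamma>)
           * mderivative (Poly_Mapping.map_key Inr \<gamma>) (single \<alpha> 1)) \<alpha>)"
    by (simp add: diff_op_def lookup_sum)
  also have "\<dots> = (\<Sum>\<gamma>\<in>keys F. if \<forall>i. lookup \<gamma> (Inl i) = lookup \<gamma> (Inr i)
     then lookup F \<gamma> * (\<Prod>i\<in>UNIV. falling (lookup \<gamma> (Inr i)) (lookup \<alpha> i)) else 0)"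
  proof (rule sum.cong[OF refl])
    fix \<gamma> assume "\<gamma> \<in> keys F"
    show "lookup (single (Poly_Mapping.map_key Inl \<gamma>) (lookup F \<gamma>)
           * mderivative (Poly_Mapping.map_key Inr \<gamma>) (single \<alpha> 1)) \<alpha> =
      (if \<forall>i. lookup \<gamma> (Inl i) = lookup \<gamma> (Inr i)
       then lookup F \<gamma> * (\<Prod>i\<in>UNIV. falling (lookup \<gamma> (Inr i)) (lookup \<alpha> i)) else 0)"
    proof (cases "\<forall>i. lookup \<gamma> (Inr i) \<le> lookup \<alpha> i")
      case True
      have "Poly_Mapping.map_key Inl \<gamma> + (\<alpha> - Poly_Mapping.map_key Inr \<gamma>) = \<alpha> \<longleftrightarrow>
          (\<forall>i. lookup \<gamma> (Inl i) + (lookup \<alpha> i - lookup \<gamma> (Inr i)) = lookup \<alpha> i)"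
        by (simp add: poly_mapping_eq_iff fun_eq_iff lookup_add lookup_minus
            lookup_map_key_Inl lookup_map_key_Inr)
      also have "\<dots> \<longleftrightarrow> (\<forall>i. lookup \<gamma> (Inl i) = lookup \<gamma> (Inr i))"
        using True by (intro all_cong1) (metis add_right_cancel le_add_diff_inverse)
      finally show ?thesis
        by (simp add: mderivative_single mult_single lookup_single when_def lookup_map_key_Inr)
    next
      case False
      then obtain i where "falling (lookup \<gamma> (Inr i)) (lookup \<alpha> i) = 0"
        by (auto simp: falling_eq_0_iff not_le)
      then have P0: "(\<Prod>i\<in>UNIV. falling (lookup \<gamma> (Inr i)) (lookup \<alpha> i)) = 0"
        by auto
      show ?thesis
        by (simp add: mderivative_single mult_single lookup_map_key_Inr P0)
    qed
  qed
  finally show ?thesis .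
qed


section \<open>Sufficiency\<close>

text \<open>Evaluate at the lowest index \<open>m\<close> with nonzero coefficient: lower
  coefficients are zero, and higher falling factorials vanish at \<open>m\<close>.\<close>

lemma ex_ffval_nonzero:
  assumes "f \<noteq> 0"
  shows "\<exists>k. ffval f k \<noteq> 0"
proof -
  define m where "m = (LEAST m. coeff f m \<noteq> 0)"
  have m: "coeff f m \<noteq> 0"
    unfolding m_def by (rule LeastI_ex) (use assms in \<open>auto simp: poly_eq_iff\<close>)
  have "coeff f j * falling j m = (if j = m then coeff f m * falling m m else 0)" for j
    using not_less_Least[of j "\<lambda>m. coeff f m \<noteq> 0"] falling_eq_0_iff[of j m]
    by (auto simp: m_def[symmetric] not_less)
  then have "ffval f m = (\<Sum>j\<le>degree f. if j = m then coeff f m * falling m m else 0)"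
    unfolding ffval_def by (intro sum.cong) auto
  also have "\<dots> = coeff f m * falling m m"
    using le_degree[OF m] by simp
  finally show ?thesis
    using m by (intro exI[of _ m]) (simp add: falling_eq_0_iff)
qed

lemma ffval_pCons_0: "ffval (pCons 0 g) k = real k * ffval g (k - 1)"
proof -
  have "ffval (pCons 0 g) k = (\<Sum>m\<le>Suc (degree g). coeff (pCons 0 g) m * falling m k)"
    by (rule ffval_bound) (rule degree_pCons_le)
  also have "\<dots> = (\<Sum>m\<le>degree g. coeff g m * falling (Suc m) k)"
    by (simp add: sum.atMost_Suc_shift del: sum.atMost_Suc)
  also have "\<dots> = real k * ffval g (k - 1)"
    by (simp add: falling_Suc' ffval_def sum_distrib_left mult_ac)
  finally show ?thesis .
qed

section \<open>Evaluation and restriction to one variable\<close>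

lemma meval_superset:
  assumes "finite A" "keys p \<subseteq> A"
  shows "meval p z = (\<Sum>\<alpha>\<in>A. of_real (lookup p \<alpha>) * (\<Prod>i\<in>UNIV. z i ^ lookup \<alpha> i))"
  unfolding meval_def
  by (rule sum.mono_neutral_left) (use assms in \<open>auto simp: in_keys_iff\<close>)

lemma meval_0 [simp]: "meval 0 z = 0"
  by (simp add: meval_def)

lemma meval_single: "meval (single \<alpha> c) z = of_real c * (\<Prod>i\<in>UNIV. z i ^ lookup \<alpha> i)"
  using meval_superset[of "{\<alpha>}" "single \<alpha> c" z] by simp

lemma meval_add: "meval (p + q) z = meval p z + meval q z"
proof -
  let ?A = "keys p \<union> keys q"
  have "keys (p + q) \<subseteq> ?A" by (rule Poly_Mapping.keys_add)
  then show ?thesis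
    using meval_superset[of ?A "p + q" z] meval_superset[of ?A p z] meval_superset[of ?A q z]
    by (simp add: lookup_add distrib_right sum.distrib)
qed

lemma meval_sum: "meval (\<Sum>x\<in>A. p x) z = (\<Sum>x\<in>A. meval (p x) z)"
  by (induction A rule: infinite_finite_induct) (auto simp: meval_add)

lemma prod_power_add_single:
  fixes z :: "'n::finite \<Rightarrow> complex"
  shows "(\<Prod>j\<in>UNIV. z j ^ lookup (\<alpha> + single i k) j) = (\<Prod>j\<in>UNIV. z j ^ lookup \<alpha> j) * z i ^ k"
proof -
  have "(\<Prod>j\<in>UNIV. z j ^ lookup (single i k) j) = (\<Prod>j\<in>UNIV. if j = i then z i ^ k else 1)"
    by (rule prod.cong) (auto simp: lookup_single when_def)
  then show ?thesis
    by (simp add: lookup_add power_add prod.distrib)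
qed

lemma meval_mvar_mult: "meval (mvar i * p) z = z i * meval p z"
proof (induction p rule: poly_mapping_add_induct)
  case (add p \<alpha> c)
  have "meval (mvar i * single \<alpha> c) z = z i * meval (single \<alpha> c) z"
    using prod_power_add_single[of z \<alpha> i 1]
    by (simp add: mvar_def mult_single meval_single add.commute[of _ \<alpha>])
  with add show ?case
    by (simp add: distrib_left meval_add)
qed simp

lemma real_stable_mvar_mult: "real_stable p \<Longrightarrow> real_stable (mvar i * p)"
  unfolding real_stable_def meval_mvar_mult
  by (metis less_irrefl mult_eq_0_iff zero_complex.simps(2))

text \<open>The polynomial in the variable \<open>i\<close> obtained by fixing the other
  coordinates; one-variable root arguments apply to it.\<close>

definition slice :: "'n::finite \<Rightarrow> ('n \<Rightarrow> complex) \<Rightarrow> 'n mpoly \<Rightarrow> complex poly"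
  where "slice i z p = (\<Sum>\<alpha>\<in>keys p.
    monom (of_real (lookup p \<alpha>) * (\<Prod>j\<in>UNIV - {i}. z j ^ lookup \<alpha> j)) (lookup \<alpha> i))"

lemma slice_superset:
  assumes "finite A" "keys p \<subseteq> A"
  shows "slice i z p = (\<Sum>\<alpha>\<in>A.
    monom (of_real (lookup p \<alpha>) * (\<Prod>j\<in>UNIV - {i}. z j ^ lookup \<alpha> j)) (lookup \<alpha> i))"
  unfolding slice_def
  by (rule sum.mono_neutral_left) (use assms in \<open>auto simp: in_keys_iff\<close>)

lemma slice_0 [simp]: "slice i z 0 = 0"
  by (simp add: slice_def)

lemma slice_single:
  "slice i z (single \<alpha> c) = monom (of_real c * (\<Prod>j\<in>UNIV - {i}. z j ^ lookup \<alpha> j)) (lookup \<alpha> i)"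
  using slice_superset[of "{\<alpha>}" "single \<alpha> c" i z] by simp

lemma slice_add: "slice i z (p + q) = slice i z p + slice i z q"
proof -
  let ?A = "keys p \<union> keys q"
  have "keys (p + q) \<subseteq> ?A" by (rule Poly_Mapping.keys_add)
  then show ?thesis
    using slice_superset[of ?A "p + q" i z] slice_superset[of ?A p i z] slice_superset[of ?A q i z]
    by (simp add: lookup_add distrib_right sum.distrib add_monom[symmetric])
qed

lemma poly_slice: "poly (slice i z p) x = meval p (z(i := x))"
proof (induction p rule: poly_mapping_add_induct)
  case (add p \<alpha> c)
  have "(\<Prod>j\<in>UNIV. (z(i := x)) j ^ lookup \<alpha> j) = x ^ lookup \<alpha> i * (\<Prod>j\<in>UNIV - {i}. z j ^ lookup \<alpha> j)"
    by (subst prod.remove[of _ i]) (auto intro!: prod.cong)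
  with add show ?case
    by (simp add: slice_add meval_add slice_single meval_single poly_monom)
qed simp

lemma slice_pderivative: "slice i z (pderivative i p) = pderiv (slice i z p)"
proof (induction p rule: poly_mapping_add_induct)
  case (add p \<alpha> c)
  have "(\<Prod>j\<in>UNIV - {i}. z j ^ lookup (\<alpha> - single i 1) j) = (\<Prod>j\<in>UNIV - {i}. z j ^ lookup \<alpha> j)"
    by (rule prod.cong) (auto simp: lookup_minus lookup_single)
  with add show ?case
    by (simp add: pderivative_add slice_add slice_single pderivative_single pderiv_add pderiv_monom
        lookup_minus mult_ac)
qed simp

section \<open>Univariate polynomials without zeros in the upper half plane\<close>

definition upper_nonvanishing :: "complex poly \<Rightarrow> bool"
  where "upper_nonvanishing P \<longleftrightarrow> (\<forall>u. Im u > 0 \<longrightarrow> poly P u \<noteq> 0)"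

lemma upper_nonvanishing_slice:
  assumes "real_stable p" "\<And>j. Im (z j) > 0"
  shows "upper_nonvanishing (slice i z p)"
  unfolding upper_nonvanishing_def
proof (intro allI impI)
  fix u :: complex assume "Im u > 0"
  with assms show "poly (slice i z p) u \<noteq> 0"
    unfolding poly_slice real_stable_def by (metis fun_upd_apply)
qed

lemma Im_inverse_nonpos: "Im w > 0 \<Longrightarrow> Im (1 / w) \<le> 0"
  by (simp add: Im_divide)

text \<open>The logarithmic derivative is the sum of \<open>1 / (u - a)\<close> over the roots
  \<open>a\<close>. None of them lies in the upper half plane, so each term has nonpositive
  imaginary part; the induction removes one root at a time.\<close>

lemma Im_log_deriv_nonpos:
  assumes "upper_nonvanishing P" "Im u > 0"
  shows "Im (poly (pderiv P) u / poly P u) \<le> 0"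
  using assms(1)
proof (induction "degree P" arbitrary: P)
  case 0
  then show ?case
    by (metis div_0 pderiv_eq_0_iff poly_0 order_refl zero_complex.simps(2))
next
  case (Suc n)
  then obtain a where "poly P a = 0"
    using alg_closed_imp_poly_has_root[of P] by auto
  then obtain Q where P: "P = [:- a, 1:] * Q"
    by (metis dvdE poly_eq_0_iff_dvd)
  have a: "Im a \<le> 0"
    using Suc.prems \<open>poly P a = 0\<close> by (force simp: upper_nonvanishing_def)
  have "Q \<noteq> 0" using Suc.hyps P by auto
  then have "degree P = Suc (degree Q)"
    unfolding P by (subst degree_mult_eq) auto
  with Suc.hyps have "n = degree Q" by simp
  moreover have Q: "upper_nonvanishing Q"
    using Suc.prems by (auto simp: upper_nonvanishing_def P)
  ultimately have IH: "Im (poly (pderiv Q) u / poly Q u) \<le> 0"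
    by (rule Suc.hyps)
  have "poly Q u \<noteq> 0" using Q assms by (auto simp: upper_nonvanishing_def)
  moreover have "u - a \<noteq> 0" using a assms by auto
  moreover have "poly (pderiv P) u = poly Q u + (u - a) * poly (pderiv Q) u"
    unfolding P pderiv_mult by (simp add: pderiv_pCons algebra_simps)
  moreover have "poly P u = (u - a) * poly Q u"
    unfolding P by (simp add: algebra_simps)
  ultimately have "poly (pderiv P) u / poly P u = 1 / (u - a) + poly (pderiv Q) u / poly Q u"
    by (simp add: add_divide_distrib)
  moreover have "Im (1 / (u - a)) \<le> 0"
    by (rule Im_inverse_nonpos) (use a assms in auto)
  ultimately show ?case using IH by simp
qed

lemma upper_nonvanishing_deriv_shift:
  assumes "upper_nonvanishing P" "Im x > 0" "r > 0"
  shows "upper_nonvanishing (smult (of_real r) P + smult x (pderiv P))"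
  unfolding upper_nonvanishing_def
proof (intro allI impI notI)
  fix u assume u: "Im u > 0" and "poly (smult (of_real r) P + smult x (pderiv P)) u = 0"
  then have "x * poly (pderiv P) u = - of_real r * poly P u"
    by (simp add: add_eq_0_iff)
  moreover have "x \<noteq> 0" "poly P u \<noteq> 0" using assms u by (auto simp: upper_nonvanishing_def)
  ultimately have "poly (pderiv P) u / poly P u = - of_real r * (1 / x)"
    by (simp add: field_simps)
  moreover have "Im (- of_real r * (1 / x)) > 0"
    using assms by (simp add: Im_divide divide_simps sum_power2_gt_zero_iff)
  ultimately show False
    using Im_log_deriv_nonpos[OF assms(1) u] by simp
qed

section \<open>Operators with a frozen parameter\<close>

lemma higher_pderiv_monom_falling:
  "(pderiv ^^ m) (monom c k) = monom (of_real (falling m k) * c :: complex) (k - m)"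
proof (induction m)
  case (Suc m)
  have "k - m - 1 = k - Suc m" by simp
  with Suc show ?case
    by (simp add: pderiv_monom falling_Suc mult_ac)
qed simp

text \<open>The operator \<open>f(x \<partial>)\<close> with \<open>x\<close> treated as a parameter; setting the variable equal
  to \<open>x\<close> afterwards gives the normally ordered operator with symbol \<open>f(z w)\<close>.\<close>

definition par_op :: "complex \<Rightarrow> real poly \<Rightarrow> complex poly \<Rightarrow> complex poly"
  where "par_op x f P = (\<Sum>m\<le>degree f. smult (of_real (coeff f m) * x ^ m) ((pderiv ^^ m) P))"

lemma par_op_bound:
  assumes "degree f \<le> N"
  shows "par_op x f P = (\<Sum>m\<le>N. smult (of_real (coeff f m) * x ^ m) ((pderiv ^^ m) P))"
  unfolding par_op_def
  by (rule sum.mono_neutral_left) (use assms in \<open>auto simp: coeff_eq_0 not_le\<close>)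

lemma par_op_0 [simp]: "par_op x f 0 = 0"
  by (simp add: par_op_def)

lemma par_op_add: "par_op x f (P + Q) = par_op x f P + par_op x f Q"
  by (simp add: par_op_def higher_pderiv_add smult_add_right sum.distrib)

lemma par_op_const: "par_op x [:c:] P = smult (of_real c) P"
  by (simp add: par_op_def)

lemma smult_sum_distrib: "smult c (\<Sum>i\<in>A. P i) = (\<Sum>i\<in>A. smult c (P i))"
  by (induction A rule: infinite_finite_induct) (auto simp: smult_add_right)

text \<open>The parameter \<open>x\<close> commutes with differentiation, so products of symbols
  become compositions and a factor \<open>t + r\<close> acts as \<open>x \<partial> + r\<close>.
  With the variable itself in place of \<open>x\<close> this would fail.\<close>

lemma par_op_linear_factor:
  "par_op x ([:r, 1:] * g) P =
     smult (of_real r) (par_op x g P) + smult x (pderiv (par_op x g P))"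
proof -
  let ?N = "Suc (degree g)"
  let ?D = "\<lambda>m. (pderiv ^^ m) P"
  have "par_op x ([:r, 1:] * g) P =
      (\<Sum>m\<le>?N. smult (of_real (coeff ([:r, 1:] * g) m) * x ^ m) (?D m))"
    using degree_mult_le[of "[:r, 1:]" g] by (intro par_op_bound) simp
  also have "\<dots> = (\<Sum>m\<le>?N. smult (of_real r) (smult (of_real (coeff g m) * x ^ m) (?D m)))
      + (\<Sum>m\<le>?N. smult (of_real (coeff (pCons 0 g) m) * x ^ m) (?D m))"
    unfolding sum.distrib[symmetric]
    by (rule sum.cong) (simp_all add: smult_add_left distrib_right mult.assoc)
  also have "(\<Sum>m\<le>?N. smult (of_real r) (smult (of_real (coeff g m) * x ^ m) (?D m))) =
      smult (of_real r) (par_op x g P)"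
    by (subst par_op_bound[of g ?N]) (simp_all add: smult_sum_distrib del: sum.atMost_Suc)
  also have "(\<Sum>m\<le>?N. smult (of_real (coeff (pCons 0 g) m) * x ^ m) (?D m)) =
      smult x (pderiv (par_op x g P))"
    by (simp add: par_op_def higher_pderiv_sum[of 1, simplified] pderiv_smult smult_sum_distrib sum.atMost_Suc_shift mult_ac
        del: sum.atMost_Suc)
  finally show ?thesis .
qed

lemma poly_par_op_monom:
  "poly (par_op x f (monom c k)) x = of_real (ffval f k) * c * x ^ k"
proof -
  have "of_real (coeff f m) * x ^ m * (of_real (falling m k) * c * x ^ (k - m)) =
      of_real (coeff f m * falling m k) * (c * x ^ k)" for m
    by (cases "m \<le> k") (simp_all add: falling_eq_0_iff power_add[symmetric])
  then have "poly (par_op x f (monom c k)) x =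
      (\<Sum>m\<le>degree f. of_real (coeff f m * falling m k) * (c * x ^ k))"
    unfolding par_op_def poly_sum by (intro sum.cong) (simp_all add: higher_pderiv_monom_falling poly_monom)
  then show ?thesis
    by (simp only: ffval_def of_real_sum sum_distrib_right mult.assoc)
qed

text \<open>It thus suffices to control \<open>par_op\<close> for each fixed parameter in the upper
  half plane and to evaluate at that same point.\<close>

lemma meval_diagonal_op_ffval:
  "meval (diagonal_op (\<lambda>\<alpha>. ffval f (lookup \<alpha> i)) p) z = poly (par_op (z i) f (slice i z p)) (z i)"
proof (induction p rule: poly_mapping_add_induct)
  case (add p \<alpha> c)
  have "(\<Prod>j\<in>UNIV. z j ^ lookup \<alpha> j) = z i ^ lookup \<alpha> i * (\<Prod>j\<in>UNIV - {i}. z j ^ lookup \<alpha> j)"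
    by (subst prod.remove[of _ i]) auto
  with add show ?case
    by (simp add: diagonal_op_add meval_add slice_add par_op_add slice_single poly_par_op_monom
        diagonal_op_single meval_single mult_ac)
qed simp

lemma map_poly_of_real_mult:
  "map_poly complex_of_real (p * q) = map_poly of_real p * map_poly of_real q"
  by (rule poly_eqI) (simp add: coeff_map_poly coeff_mult)

lemma map_poly_of_real_add:
  "map_poly complex_of_real (p + q) = map_poly of_real p + map_poly of_real q"
  by (rule poly_eqI) (simp add: coeff_map_poly)

lemma degree_map_poly_of_real [simp]: "degree (map_poly complex_of_real p) = degree p"
  by (rule degree_map_poly) auto

lemma poly_map_poly_of_real:
  "poly (map_poly complex_of_real p) (of_real x) = of_real (poly p x)"
  by (simp add: poly_altdef coeff_map_poly)

text \<open>A complex root exists by algebraic closedness and is real and nonpositive by assumption,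
  so a real linear factor with \<open>r \<ge> 0\<close> splits off.\<close>

lemma only_real_nonpos_zeros_induct [consumes 1, case_names const factor]:
  assumes "only_real_nonpos_zeros f"
    and const: "\<And>c. c \<noteq> 0 \<Longrightarrow> Q [:c:]"
    and factor: "\<And>r g. r \<ge> 0 \<Longrightarrow> only_real_nonpos_zeros g \<Longrightarrow> Q g \<Longrightarrow> Q ([:r, 1:] * g)"
  shows "Q f"
  using assms(1)
proof (induction "degree f" arbitrary: f)
  case 0
  then obtain c where "f = [:c:]" by (metis degree_eq_zeroE)
  with 0 const show ?case by (auto simp: only_real_nonpos_zeros_def)
next
  case (Suc n)
  have "degree (map_poly of_real f :: complex poly) > 0"
    using Suc.hyps(2) by simp
  then obtain a where a: "poly (map_poly of_real f) a = (0 :: complex)"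
    using alg_closed_imp_poly_has_root by blast
  then have "a \<in> \<real>" "Re a \<le> 0" using Suc.prems by (auto simp: only_real_nonpos_zeros_def)
  define r where "r = - Re a"
  have "a = of_real (- r)" using \<open>a \<in> \<real>\<close> by (simp add: r_def)
  with a have "poly f (- r) = 0" by (simp only: poly_map_poly_of_real of_real_eq_0_iff)
  then obtain g where f: "f = [:r, 1:] * g"
    by (metis dvdE poly_eq_0_iff_dvd minus_minus)
  have "g \<noteq> 0" using Suc.hyps f by auto
  then have "degree f = Suc (degree g)"
    unfolding f by (subst degree_mult_eq) auto
  then have "n = degree g" using Suc.hyps by simp
  moreover have g: "only_real_nonpos_zeros g"
    using Suc.prems \<open>g \<noteq> 0\<close> unfolding only_real_nonpos_zeros_def f map_poly_of_real_mult poly_mult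
    by simp
  ultimately have "Q g" by (rule Suc.hyps)
  with g show ?case
    unfolding f using \<open>Re a \<le> 0\<close> by (intro factor) (auto simp: r_def)
qed

text \<open>A nonzero value at 0 forces every \<open>r\<close> to be positive, as
  \<open>upper_nonvanishing_deriv_shift\<close> requires.\<close>

lemma upper_nonvanishing_par_op:
  assumes "only_real_nonpos_zeros f" "poly f 0 \<noteq> 0" "upper_nonvanishing P" "Im x > 0"
  shows "upper_nonvanishing (par_op x f P)"
  using assms(1,2)
proof (induction f rule: only_real_nonpos_zeros_induct)
  case (const c)
  then show ?case using assms(3) by (simp add: par_op_const upper_nonvanishing_def)
next
  case (factor r g)
  then have "r > 0" "poly g 0 \<noteq> 0" by auto
  with factor show ?case
    unfolding par_op_linear_factor by (intro upper_nonvanishing_deriv_shift assms) auto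
qed

section \<open>Partial derivatives and preservation of stability\<close>

lemma meval_vanishing_imp_0:
  fixes p :: "'n::finite mpoly"
  assumes "\<And>z. (\<And>i. Im (z i) > 0) \<Longrightarrow> meval p z = 0"
  shows "p = 0"
proof -
  have inf: "infinite {x. Im x > 0}"
  proof -
    have "inj (\<lambda>n. Complex 0 (real (Suc n)))" by (auto simp: inj_def)
    then have "infinite (range (\<lambda>n. Complex 0 (real (Suc n))))"
      by (rule range_inj_infinite)
    then show ?thesis by (rule infinite_super[rotated]) auto
  qed
  \<comment> \<open>Coefficients are compared in one variable after another. Once \<open>S\<close>
    contains all variables, only the coefficient at \<beta> is left.\<close>
  have *: "(\<Sum>\<alpha> | \<alpha> \<in> A \<and> (\<forall>i\<in>S. lookup \<alpha> i = lookup \<beta> i). c \<alpha>) = 0"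
    if "finite S" "finite A" "\<And>z. (\<And>i. Im (z i) > 0) \<Longrightarrow> (\<Sum>\<alpha>\<in>A. c \<alpha> * (\<Prod>i\<in>S. z i ^ lookup \<alpha> i)) = 0"
    for S :: "'n set" and A and c :: "'n midx \<Rightarrow> complex" and \<beta>
    using that
  proof (induction S arbitrary: A rule: finite_induct)
    case empty
    then show ?case using empty(2)[of "\<lambda>_. \<i>"] by simp
  next
    case (insert j S)
    let ?A = "{\<alpha>\<in>A. lookup \<alpha> j = lookup \<beta> j}"
    have "(\<Sum>\<alpha>\<in>?A. c \<alpha> * (\<Prod>i\<in>S. z i ^ lookup \<alpha> i)) = 0" if z: "\<And>i. Im (z i) > 0" for z
    proof -
      \<comment> \<open>The sum as a polynomial in the variable \<open>j\<close> alone: it has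
        infinitely many zeros, and the part with exponent \<open>lookup \<beta> j\<close> is one of
        its coefficients.\<close>
      define R where "R = (\<Sum>\<alpha>\<in>A. monom (c \<alpha> * (\<Prod>i\<in>S. z i ^ lookup \<alpha> i)) (lookup \<alpha> j))"
      have "poly R x = 0" if "Im x > 0" for x
      proof -
        have "(\<Prod>i\<in>S. (z(j := x)) i ^ lookup \<alpha> i) = (\<Prod>i\<in>S. z i ^ lookup \<alpha> i)" for \<alpha>
          using insert.hyps by (intro prod.cong) auto
        moreover have "(\<Sum>\<alpha>\<in>A. c \<alpha> * (\<Prod>i\<in>insert j S. (z(j := x)) i ^ lookup \<alpha> i)) = 0"
          by (rule insert.prems) (use z that in auto)
        ultimately show ?thesis
          using insert.hyps by (simp add: R_def poly_sum poly_monom mult_ac)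
      qed
      then have "{x. Im x > 0} \<subseteq> {x. poly R x = 0}" by auto
      then have "R = 0" using inf poly_roots_finite finite_subset by blast
      have "(\<Sum>\<alpha>\<in>?A. c \<alpha> * (\<Prod>i\<in>S. z i ^ lookup \<alpha> i)) = (\<Sum>\<alpha>\<in>A.
          if lookup \<alpha> j = lookup \<beta> j then c \<alpha> * (\<Prod>i\<in>S. z i ^ lookup \<alpha> i) else 0)"
        by (rule sum.inter_filter[OF insert.prems(1)])
      also have "\<dots> = coeff R (lookup \<beta> j)"
        unfolding R_def coeff_sum coeff_monom ..
      finally show ?thesis
        using \<open>R = 0\<close> by simp
    qed
    from insert.IH[OF _ this] insert.prems(1)
    have "(\<Sum>\<alpha> | \<alpha> \<in> ?A \<and> (\<forall>i\<in>S. lookup \<alpha> i = lookup \<beta> i). c \<alpha>) = 0" by simp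
    moreover have "{\<alpha>. \<alpha> \<in> ?A \<and> (\<forall>i\<in>S. lookup \<alpha> i = lookup \<beta> i)} =
      {\<alpha>. \<alpha> \<in> A \<and> (\<forall>i\<in>insert j S. lookup \<alpha> i = lookup \<beta> i)}" by auto
    ultimately show ?case by simp
  qed
  have "lookup p \<beta> = 0" for \<beta>
  proof (rule ccontr)
    assume "lookup p \<beta> \<noteq> 0"
    then have "{\<alpha>. \<alpha> \<in> keys p \<and> (\<forall>i\<in>UNIV. lookup \<alpha> i = lookup \<beta> i)} = {\<beta>}"
      by (auto simp: in_keys_iff intro: poly_mapping_eqI)
    moreover have "(\<Sum>\<alpha> | \<alpha> \<in> keys p \<and> (\<forall>i\<in>UNIV. lookup \<alpha> i = lookup \<beta> i).
        complex_of_real (lookup p \<alpha>)) = 0"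
      by (rule *) (use assms in \<open>auto simp: meval_def\<close>)
    ultimately show False using \<open>lookup p \<beta> \<noteq> 0\<close> by simp
  qed
  then show ?thesis by (intro poly_mapping_eqI) simp
qed

text \<open>\<open>\<partial>\<^sub>i p / p\<close> maps the product of upper half planes into the closed lower half plane, so by the open
  mapping theorem it can only vanish somewhere if it vanishes identically.\<close>

lemma pderivative_stable:
  fixes p :: "'n::finite mpoly"
  assumes "real_stable p"
  shows "pderivative i p = 0 \<or> real_stable (pderivative i p)"
proof (rule disjCI)
  assume "\<not> real_stable (pderivative i p)"
  then obtain u where u: "\<And>j. Im (u j) > 0" "meval (pderivative i p) u = 0"
    by (auto simp: real_stable_def)
  show "pderivative i p = 0"
  proof (rule meval_vanishing_imp_0)
    fix v :: "'n \<Rightarrow> complex" assume v: "\<And>j. Im (v j) > 0"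
    \<comment> \<open>The complex line through \<open>u\<close> at \<open>s = 0\<close> and
      \<open>v\<close> at \<open>s = 1\<close>; the parameters that land in the product of upper
      half planes form the open convex set \<open>S\<close>.\<close>
    define w where "w = (\<lambda>s j. u j + s * (v j - u j))"
    define S where "S = (\<Inter>j. {s. Im (w s j) > 0})"
    define h where "h = (\<lambda>s. meval (pderivative i p) (w s) / meval p (w s))"
    have w_le: "{s. Im (w s j) > 0} = {s. inner (cnj (\<i> * (v j - u j))) s < Im (u j)}" for j
      by (auto simp: w_def inner_complex_def algebra_simps)
    have "open S"
      unfolding S_def w_le by (intro open_INT ballI open_halfspace_lt finite)
    have "convex S"
      unfolding S_def w_le by (intro convex_INT convex_halfspace_lt)
    have mem: "0 \<in> S" "1 \<in> S" using u v by (auto simp: S_def w_def)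
    have nz: "meval p (w s) \<noteq> 0" if "s \<in> S" for s
      using assms that by (auto simp: real_stable_def S_def)
    have hol: "(\<lambda>s. meval q (w s)) holomorphic_on A" for q :: "'n mpoly" and A
      unfolding meval_def w_def by (intro holomorphic_intros)
    have "h holomorphic_on S"
      unfolding h_def by (intro holomorphic_intros hol nz)
    moreover have "Im (h s) \<le> 0" if "s \<in> S" for s
    proof -
      have s: "Im (w s j) > 0" for j using that by (auto simp: S_def)
      have "h s = poly (pderiv (slice i (w s) p)) (w s i) / poly (slice i (w s) p) (w s i)"
        by (simp add: h_def slice_pderivative[symmetric] poly_slice)
      then show ?thesis
        using Im_log_deriv_nonpos[OF upper_nonvanishing_slice[OF assms s, of i] s[of i]] by simp
    qed
    moreover have h0: "h 0 = 0" using u by (simp add: h_def w_def)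
    ultimately have "h constant_on S"
    proof -
      have False if "\<not> h constant_on S"
      proof -
        have "open (h ` S)"
          by (rule open_mapping_thm[OF \<open>h holomorphic_on S\<close> \<open>open S\<close> _ \<open>open S\<close> order_refl that])
             (rule convex_connected[OF \<open>convex S\<close>])
        moreover have "0 \<in> h ` S" using h0 mem by force
        ultimately obtain e where e: "e > 0" "ball 0 e \<subseteq> h ` S"
          by (meson openE)
        \<comment> \<open>An open image around 0 would contain a point of the positive imaginary
          axis.\<close>
        have "\<i> * of_real (e / 2) \<in> ball 0 e" using e by (simp add: norm_mult)
        with e obtain s where s: "s \<in> S" "h s = \<i> * of_real (e / 2)" by (metis imageE subsetD)
        have "Im (h s) = e / 2" unfolding s(2) by simp
        then show False using \<open>\<And>s. s \<in> S \<Longrightarrow> Im (h s) \<le> 0\<close>[of s] s e by simp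
      qed
      then show ?thesis by blast
    qed
    then have "h 1 = 0" using mem h0 unfolding constant_on_def by metis
    then show "meval (pderivative i p) v = 0"
      using nz[of 1] mem by (simp add: h_def w_def)
  qed
qed

text \<open>A factor \<open>t\<close> of the symbol corresponds to
  \<open>z_i T_g \<partial>_i\<close>, where \<open>T_g\<close> has symbol
  \<open>g(z_i w_i)\<close>. This deals with a zero at the origin, which the parameter argument
  excludes.\<close>

lemma diagonal_op_ffval_pCons_0:
  "diagonal_op (\<lambda>\<alpha>. ffval (pCons 0 g) (lookup \<alpha> i)) p =
     mvar i * diagonal_op (\<lambda>\<alpha>. ffval g (lookup \<alpha> i)) (pderivative i p)"
proof (induction p rule: poly_mapping_add_induct)
  case (add p \<alpha> c)
  have "single i 1 + (\<alpha> - single i 1) = \<alpha>" if "lookup \<alpha> i \<noteq> 0"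
    by (rule poly_mapping_eqI) (use that in \<open>auto simp: lookup_add lookup_minus lookup_single when_def\<close>)
  with add show ?case
    by (cases "lookup \<alpha> i = 0") (simp_all add: diagonal_op_add diagonal_op_single pderivative_add
       pderivative_single distrib_left mvar_def mult_single ffval_pCons_0 lookup_minus mult_ac)
qed simp

lemma diagonal_op_ffval_stable:
  assumes "only_real_nonpos_zeros f" "real_stable p"
  shows "diagonal_op (\<lambda>\<alpha>. ffval f (lookup \<alpha> i)) p = 0 \<or>
         real_stable (diagonal_op (\<lambda>\<alpha>. ffval f (lookup \<alpha> i)) p)"
  using assms
proof (induction "degree f" arbitrary: f p rule: less_induct)
  case less
  show ?case
  proof (cases "poly f 0 = 0")
    case True
    then obtain g where f: "f = pCons 0 g"
      by (metis pCons_cases poly_pCons mult_zero_left add.right_neutral)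
    have "f \<noteq> 0" using less.prems by (simp add: only_real_nonpos_zeros_def)
    then have "g \<noteq> 0" using f by auto
    then have "degree g < degree f" using f by simp
    moreover have "only_real_nonpos_zeros g"
      using less.prems(1) \<open>g \<noteq> 0\<close> unfolding only_real_nonpos_zeros_def f by (auto simp: map_poly_pCons)
    ultimately have "diagonal_op (\<lambda>\<alpha>. ffval g (lookup \<alpha> i)) (pderivative i p) = 0 \<or>
        real_stable (diagonal_op (\<lambda>\<alpha>. ffval g (lookup \<alpha> i)) (pderivative i p))"
      using less.hyps[of g "pderivative i p"] pderivative_stable[OF less.prems(2), of i] by auto
    then show ?thesis
      unfolding f diagonal_op_ffval_pCons_0 by (auto intro: real_stable_mvar_mult)
  next
    case False
    have "real_stable (diagonal_op (\<lambda>\<alpha>. ffval f (lookup \<alpha> i)) p)"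
      unfolding real_stable_def meval_diagonal_op_ffval
    proof (intro allI impI)
      fix z :: "'a \<Rightarrow> complex" assume z: "\<forall>i. Im (z i) > 0"
      have "upper_nonvanishing (par_op (z i) f (slice i z p))"
        by (rule upper_nonvanishing_par_op[OF less.prems(1) False upper_nonvanishing_slice])
           (use z less.prems in auto)
      then show "poly (par_op (z i) f (slice i z p)) (z i) \<noteq> 0"
        using z by (simp add: upper_nonvanishing_def)
    qed
    then show ?thesis ..
  qed
qed

lemma diagonal_op_compose:
  "diagonal_op (\<lambda>\<alpha>. a \<alpha> * b \<alpha>) p = diagonal_op a (diagonal_op b p)"
  by (rule poly_mapping_eqI) (simp add: lookup_diagonal_op)

lemma diagonal_op_1: "diagonal_op (\<lambda>\<alpha>. 1) p = p"
  by (rule poly_mapping_eqI) (simp add: lookup_diagonal_op)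

lemma diagonal_op_prod_ffval_stable:
  assumes "\<And>i. only_real_nonpos_zeros (f i)" "real_stable p" "finite S"
  shows "diagonal_op (\<lambda>\<alpha>. \<Prod>i\<in>S. ffval (f i) (lookup \<alpha> i)) p = 0 \<or>
         real_stable (diagonal_op (\<lambda>\<alpha>. \<Prod>i\<in>S. ffval (f i) (lookup \<alpha> i)) p)"
  using assms(3)
proof (induction S rule: finite_induct)
  case empty
  then show ?case using assms(2) by (simp add: diagonal_op_1)
next
  case (insert i S)
  then show ?case
    using diagonal_op_ffval_stable[OF assms(1), of _ i i] by (auto simp: diagonal_op_compose)
qed

lemma prod_symbol_preserves_stability:
  fixes f :: "'n::finite \<Rightarrow> real poly"
  assumes f: "\<And>i. only_real_nonpos_zeros (f i)"
    and sym: "is_symbol (diagonal_op l) (\<Prod>i\<in>UNIV. msubst (f i) (mvar (Inl i) * mvar (Inr i)))"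
  shows "diagonal_op l \<in> stability_preserving_diff_ops"
proof -
  have l: "l = (\<lambda>\<alpha>. \<Prod>i\<in>UNIV. ffval (f i) (lookup \<alpha> i))"
    using sym by (auto simp: is_symbol_prod_msubst_iff)
  have "\<forall>i. \<exists>k. ffval (f i) k \<noteq> 0"
    using f by (auto simp: only_real_nonpos_zeros_def intro: ex_ffval_nonzero)
  then obtain k where k: "\<And>i. ffval (f i) (k i) \<noteq> 0" by metis
  define \<alpha> where "\<alpha> = (\<Sum>i\<in>UNIV. single i (k i))"
  have "lookup \<alpha> i = k i" for i by (simp add: \<alpha>_def lookup_sum lookup_single when_def)
  then have "l \<alpha> \<noteq> 0" using k by (simp add: l)
  then have "lookup (diagonal_op l (single \<alpha> 1)) \<alpha> \<noteq> 0" by (simp add: lookup_diagonal_op)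
  then have "diagonal_op l \<noteq> (\<lambda>p. 0)" by auto
  moreover have "diagonal_op l \<in> diff_ops" using sym by (auto simp: diff_ops_def)
  moreover have "diagonal_op l p = 0 \<or> real_stable (diagonal_op l p)" if "real_stable p" for p
    unfolding l by (rule diagonal_op_prod_ffval_stable) (use f that in auto)
  ultimately show ?thesis by (auto simp: stability_preserving_diff_ops_def)
qed


section \<open>Univariate multiplier sequences\<close>

abbreviation cpoly :: "real poly \<Rightarrow> complex poly"
  where "cpoly \<equiv> map_poly complex_of_real"

definition diag_poly :: "(nat \<Rightarrow> real) \<Rightarrow> real poly \<Rightarrow> real poly"
  where "diag_poly \<mu> q = (\<Sum>k\<le>degree q. monom (\<mu> k * coeff q k) k)"

lemma coeff_diag_poly [simp]: "coeff (diag_poly \<mu> q) k = \<mu> k * coeff q k"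
  by (cases "k \<le> degree q") (simp_all add: diag_poly_def coeff_sum coeff_eq_0)

lemma diag_poly_add: "diag_poly \<mu> (p + q) = diag_poly \<mu> p + diag_poly \<mu> q"
  by (rule poly_eqI) (simp add: algebra_simps)

lemma diag_poly_monom: "diag_poly \<mu> (monom c k) = monom (\<mu> k * c) k"
  by (rule poly_eqI) simp

text \<open>Multiplier sequences in the sense of Polya and Schur: by conjugation symmetry, a real
  polynomial without zeros in the upper half plane is a nonzero polynomial with only real
  zeros.\<close>

definition multiplier :: "(nat \<Rightarrow> real) \<Rightarrow> bool"
  where "multiplier \<mu> \<longleftrightarrow> (\<forall>q. upper_nonvanishing (cpoly q) \<longrightarrow>
    diag_poly \<mu> q = 0 \<or> upper_nonvanishing (cpoly (diag_poly \<mu> q)))"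

definition poly_seq :: "(nat \<Rightarrow> real) \<Rightarrow> bool"
  where "poly_seq \<mu> \<longleftrightarrow> (\<exists>F. \<forall>k. \<mu> k = poly F (real k))"

lemma poly_seq_diff: "poly_seq \<mu> \<Longrightarrow> poly_seq \<nu> \<Longrightarrow> poly_seq (\<lambda>k. \<mu> k - \<nu> k)"
  unfolding poly_seq_def by (metis poly_diff)

lemma poly_seq_cmult: "poly_seq \<mu> \<Longrightarrow> poly_seq (\<lambda>k. c * \<mu> k)"
  unfolding poly_seq_def by (metis poly_smult)

lemma poly_seq_shift:
  assumes "poly_seq \<mu>"
  shows "poly_seq (\<lambda>k. \<mu> (n + k))"
proof -
  from assms obtain F where "\<And>k. \<mu> k = poly F (real k)" by (auto simp: poly_seq_def)
  then have "\<mu> (n + k) = poly (pcompose F [:real n, 1:]) (real k)" for k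
    by (simp add: poly_pcompose)
  then show ?thesis by (auto simp: poly_seq_def)
qed

lemma falling_eq_poly: "falling m k = poly (\<Prod>j<m. [:- real j, 1:]) (real k)"
proof (induction m)
  case (Suc m)
  have "falling (Suc m) k = (real k - real m) * falling m k"
    by (cases "m \<le> k") (simp_all add: falling_Suc of_nat_diff falling_eq_0_iff)
  with Suc show ?case by (simp add: algebra_simps)
qed simp

lemma poly_seq_ffval: "poly_seq (ffval f)"
proof -
  have "ffval f k = poly (\<Sum>m\<le>degree f. smult (coeff f m) (\<Prod>j<m. [:- real j, 1:])) (real k)" for k
    by (simp add: ffval_def poly_sum falling_eq_poly)
  then show ?thesis by (auto simp: poly_seq_def)
qed

lemma poly_seq_eq_0:
  assumes "poly_seq \<mu>" "\<And>k. k \<ge> n \<Longrightarrow> \<mu> k = 0"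
  shows "\<mu> k = 0"
proof -
  from assms(1) obtain F where F: "\<And>k. \<mu> k = poly F (real k)" by (auto simp: poly_seq_def)
  have "infinite (real ` {n..})"
    by (subst finite_image_iff) (auto simp: infinite_Ici)
  moreover have "real ` {n..} \<subseteq> {x. poly F x = 0}"
    using assms(2) F by auto
  ultimately have "F = 0" using poly_roots_finite finite_subset by blast
  then show ?thesis by (simp add: F)
qed

section \<open>Zero patterns and signs of multiplier sequences\<close>

lemma upper_nonvanishing_cpoly_monom_mult:
  "upper_nonvanishing (cpoly q) \<Longrightarrow> upper_nonvanishing (cpoly (monom 1 k * q))"
  by (auto simp: upper_nonvanishing_def map_poly_of_real_mult map_poly_monom poly_monom)

text \<open>Test polynomial: \<open>z\<^sup>k (1 - z\<^sup>2)\<close>.\<close>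

lemma multiplier_sign_step:
  assumes "multiplier \<mu>"
  shows "\<mu> k * \<mu> (k + 2) \<ge> 0"
proof (rule ccontr)
  assume neg: "\<not> \<mu> k * \<mu> (k + 2) \<ge> 0"
  define q :: "real poly" where "q = monom 1 k * [:1, 0, - 1:]"
  have q: "q = monom 1 k + monom (- 1) (k + 2)"
  proof -
    have "[:1, 0, - 1:] = 1 + monom (- 1 :: real) 2"
      by (rule poly_eqI) (auto simp: coeff_pCons numeral_2_eq_2 split: nat.splits)
    then show ?thesis by (simp add: q_def distrib_left mult_monom)
  qed
  have "u * u \<noteq> 1" if "Im u > 0" for u :: complex
    using that by (metis less_irrefl square_eq_1_iff uminus_complex.simps(2) neg_0_equal_iff_equal one_complex.simps(2))
  then have "upper_nonvanishing (cpoly q)"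
    unfolding q_def by (intro upper_nonvanishing_cpoly_monom_mult)
      (auto simp: upper_nonvanishing_def map_poly_pCons)
  moreover have D: "diag_poly \<mu> q = monom (\<mu> k) k + monom (- \<mu> (k + 2)) (k + 2)"
    by (simp add: q diag_poly_add diag_poly_monom)
  moreover have "diag_poly \<mu> q \<noteq> 0"
  proof
    assume "diag_poly \<mu> q = 0"
    then have "coeff (diag_poly \<mu> q) k = 0" by simp
    then show False using neg unfolding D by simp
  qed
  ultimately have nv: "upper_nonvanishing (cpoly (diag_poly \<mu> q))"
    using assms by (auto simp: multiplier_def)
  \<comment> \<open>With a negative product the image vanishes at \<open>\<i> t\<close>, where
    \<open>t^2 = - \<mu> k / \<mu> (k + 2)\<close>.\<close>
  have "- \<mu> k / \<mu> (k + 2) > 0" using neg by (auto simp: not_le mult_less_0_iff divide_simps)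
  then obtain t where "t > 0" and t2: "t * t = - \<mu> k / \<mu> (k + 2)"
    by (metis real_sqrt_gt_zero real_sqrt_mult_self abs_of_pos)
  moreover have "\<mu> (k + 2) \<noteq> 0" using neg by auto
  ultimately have "\<mu> k + \<mu> (k + 2) * (t * t) = 0" by simp
  have "poly (cpoly (diag_poly \<mu> q)) (\<i> * of_real t) =
      (\<i> * of_real t) ^ k * of_real (\<mu> k + \<mu> (k + 2) * (t * t))"
    by (simp add: D map_poly_of_real_add map_poly_monom poly_monom power_add power2_eq_square algebra_simps)
  also have "\<dots> = 0" using \<open>\<mu> k + \<mu> (k + 2) * (t * t) = 0\<close> by simp
  finally show False
    using nv \<open>t > 0\<close> by (auto simp: upper_nonvanishing_def)
qed

text \<open>The root with argument \<open>pi / j\<close> for negative \<open>c\<close> and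
  \<open>2 pi / j\<close> for positive \<open>c\<close> lies strictly above the real axis. For
  \<open>j = 2\<close> and positive \<open>c\<close> both roots are real, hence the sign
  condition.\<close>

lemma ex_upper_root:
  assumes "c \<noteq> 0" "j \<ge> 3 \<or> j = 2 \<and> c < 0"
  shows "\<exists>w. Im w > 0 \<and> w ^ j = complex_of_real c"
proof -
  define \<theta> where "\<theta> = (if c < 0 then pi / j else 2 * pi / j)"
  define w where "w = of_real (root j \<bar>c\<bar>) * cis \<theta>"
  have j: "j > 0" using assms by auto
  have "0 < \<theta>" "\<theta> < pi" using assms pi_gt_zero by (auto simp: \<theta>_def divide_simps)
  then have "sin \<theta> > 0" by (rule sin_gt_zero)
  moreover have "root j \<bar>c\<bar> > 0" using j assms by simp
  ultimately have "Im w > 0" by (simp add: w_def)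
  have "w ^ j = of_real (root j \<bar>c\<bar> ^ j) * cis (real j * \<theta>)"
    by (simp only: w_def power_mult_distrib Complex.DeMoivre of_real_power)
  also have "root j \<bar>c\<bar> ^ j = \<bar>c\<bar>" using j by simp
  also have "of_real \<bar>c\<bar> * cis (real j * \<theta>) = of_real c"
    using j assms by (auto simp: \<theta>_def)
  finally show ?thesis using \<open>Im w > 0\<close> by blast
qed

lemma upper_nonvanishing_one_plus_power: "upper_nonvanishing (cpoly ([:1, 1:] ^ j))"
proof (induction j)
  case (Suc j)
  have "1 + u \<noteq> 0" if "Im u > 0" for u :: complex
  proof
    assume "1 + u = 0"
    then have "Im (1 + u) = 0" by (simp only: zero_complex.simps)
    then show False using that by simp
  qed
  with Suc show ?case
    by (auto simp: upper_nonvanishing_def map_poly_of_real_mult map_poly_pCons simp del: mult_pCons_left)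
qed (simp add: upper_nonvanishing_def)

text \<open>Test polynomial: \<open>z\<^sup>k (1 + z)\<^sup>j\<close>.\<close>

lemma multiplier_no_gap:
  assumes mult: "multiplier \<mu>" and "j \<ge> 2" "\<mu> k \<noteq> 0" "\<mu> (k + j) \<noteq> 0"
    and gap: "\<And>m. 0 < m \<Longrightarrow> m < j \<Longrightarrow> \<mu> (k + m) = 0"
  shows False
proof -
  define q :: "real poly" where "q = monom 1 k * [:1, 1:] ^ j"
  have one: "coeff ([:1, 1:] ^ j :: real poly) 0 = 1"
    by (simp add: poly_0_coeff_0[symmetric])
  have top: "coeff ([:1, 1:] ^ j :: real poly) j = 1"
    by (rule coeff_linear_power)
  have deg: "coeff ([:1, 1:] ^ j :: real poly) m = 0" if "m > j" for m
    by (rule coeff_eq_0) (use that in \<open>simp add: degree_linear_power\<close>)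
  \<comment> \<open>The gap kills all inner terms, so the image is a monomial times a binomial,
    whose nonzero roots are the \<open>j\<close>-th roots of
    \<open>- \<mu> k / \<mu> (k + j)\<close>.\<close>
  have D: "diag_poly \<mu> q = monom (\<mu> k) k + monom (\<mu> (k + j)) (k + j)"
  proof (rule poly_eqI)
    fix n
    show "coeff (diag_poly \<mu> q) n = coeff (monom (\<mu> k) k + monom (\<mu> (k + j)) (k + j)) n"
    proof (cases "n < k")
      case True
      then show ?thesis by (simp add: q_def coeff_monom_mult)
    next
      case False
      then obtain m where n: "n = k + m" using le_Suc_ex not_less by blast
      consider "m = 0" | "0 < m" "m < j" | "m = j" | "m > j" by linarith
      then show ?thesis
        using \<open>j \<ge> 2\<close> unfolding n
        by cases (simp_all add: q_def coeff_monom_mult one top deg gap)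
    qed
  qed
  have "upper_nonvanishing (cpoly q)"
    unfolding q_def by (intro upper_nonvanishing_cpoly_monom_mult upper_nonvanishing_one_plus_power)
  moreover have "diag_poly \<mu> q \<noteq> 0"
  proof
    assume "diag_poly \<mu> q = 0"
    then have "coeff (diag_poly \<mu> q) k = 0" by simp
    then show False using assms unfolding D by simp
  qed
  ultimately have nv: "upper_nonvanishing (cpoly (diag_poly \<mu> q))"
    using mult by (auto simp: multiplier_def)
  define c where "c = - \<mu> k / \<mu> (k + j)"
  have "c \<noteq> 0" using assms by (simp add: c_def)
  moreover have "j \<ge> 3 \<or> j = 2 \<and> c < 0"
  \<comment> \<open>Across a gap of length two the outer values have equal signs by
    \<open>multiplier_sign_step\<close>, so \<open>c\<close> is negative.\<close>
  proof (cases "j = 2")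
    case True
    then have "\<mu> k * \<mu> (k + j) > 0"
      using multiplier_sign_step[OF mult, of k] assms by (intro order_le_neq_trans) auto
    with True show ?thesis by (auto simp: c_def divide_simps zero_less_mult_iff)
  qed (use \<open>j \<ge> 2\<close> in auto)
  ultimately obtain w where w: "Im w > 0" "w ^ j = of_real c"
    using ex_upper_root by blast
  have "poly (cpoly (diag_poly \<mu> q)) w = w ^ k * (of_real (\<mu> k) + of_real (\<mu> (k + j)) * w ^ j)"
    by (simp add: D map_poly_of_real_add map_poly_monom poly_monom power_add algebra_simps)
  also have "\<dots> = 0"
    unfolding w using assms by (simp add: c_def)
  finally show False using nv w by (auto simp: upper_nonvanishing_def)
qed

text \<open>A polynomial sequence that is zero from some point on is zero everywhere, so a zero
  after a nonzero value would lie in a finite gap, contrary to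
  \<open>multiplier_no_gap\<close>.\<close>

lemma multiplier_nonzero_mono:
  assumes mult: "multiplier \<mu>" and seq: "poly_seq \<mu>" and "\<mu> n \<noteq> 0" "n \<le> k"
  shows "\<mu> k \<noteq> 0"
  using \<open>n \<le> k\<close>
proof (induction k rule: dec_induct)
  case (step k)
  show ?case
  proof
    assume 0: "\<mu> (Suc k) = 0"
    have "\<exists>m\<ge>Suc k. \<mu> m \<noteq> 0"
      using poly_seq_eq_0[OF seq, of "Suc k" n] assms(3) by blast
    then have ex: "\<exists>j>0. \<mu> (k + j) \<noteq> 0"
      by (metis Suc_le_eq less_imp_add_positive)
    define j where "j = (LEAST j. j > 0 \<and> \<mu> (k + j) \<noteq> 0)"
    have j: "j > 0" "\<mu> (k + j) \<noteq> 0"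
      using LeastI_ex[OF ex] by (auto simp: j_def)
    have "\<mu> (k + m) = 0" if "0 < m" "m < j" for m
      using not_less_Least[of m "\<lambda>j. j > 0 \<and> \<mu> (k + j) \<noteq> 0"] that by (auto simp: j_def)
    moreover have "j \<noteq> 1" using j 0 by auto
    ultimately show False
      using multiplier_no_gap[OF mult, of j k] j step by auto
  qed
qed (use assms in auto)

text \<open>For large arguments the sign is that of the leading coefficient. A value of opposite
  sign would propagate in steps of two, since no zero intervenes and
  \<open>multiplier_sign_step\<close> keeps the sign.\<close>

lemma multiplier_sign:
  assumes mult: "multiplier \<mu>" and seq: "poly_seq \<mu>"
  shows "\<exists>s. (s = 1 \<or> s = - 1) \<and> (\<forall>k. s * \<mu> k \<ge> 0)"
proof (cases "\<forall>k. \<mu> k = 0")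
  case False
  from seq obtain F where F: "\<And>k. \<mu> k = poly F (real k)" by (auto simp: poly_seq_def)
  then have "F \<noteq> 0" using False by auto
  define s :: real where "s = (if lead_coeff F > 0 then 1 else - 1)"
  have s: "s = 1 \<or> s = - 1" by (simp add: s_def)
  then have lc: "lead_coeff (smult s F) > 0"
    using \<open>F \<noteq> 0\<close> leading_coeff_neq_0[of F] by (auto simp: s_def not_less intro: order_le_neq_trans)
  then obtain x0 where x0: "\<And>x. x \<ge> x0 \<Longrightarrow> poly (smult s F) x \<ge> lead_coeff (smult s F)"
    using poly_pinfty_gt_lc by blast
  have "s * \<mu> k \<ge> 0" for k
  proof (rule ccontr)
    assume neg: "\<not> s * \<mu> k \<ge> 0"
    have all: "s * \<mu> (k + 2 * m) < 0" for m
    proof (induction m)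
      case (Suc m)
      have "\<mu> (k + 2 * Suc m) \<noteq> 0"
        by (rule multiplier_nonzero_mono[OF mult seq, of k]) (use neg in auto)
      moreover have "\<mu> (k + 2 * m) * \<mu> (k + 2 * Suc m) \<ge> 0"
        using multiplier_sign_step[OF mult, of "k + 2 * m"] by (simp add: algebra_simps)
      ultimately show ?case using Suc s by (auto simp: mult_less_0_iff zero_le_mult_iff)
    qed (use neg in simp)
    obtain m where m: "real m \<ge> x0" using real_arch_simple by blast
    then have "poly (smult s F) (real (k + 2 * m)) > 0"
      using x0[of "real (k + 2 * m)"] lc by simp
    then show False using all[of m] by (simp add: F)
  qed
  with s show ?thesis by blast
qed auto

section \<open>Locating the zeros of the symbol\<close>

lemma multiplier_cmult:
  assumes "multiplier \<mu>" "c \<noteq> 0"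
  shows "multiplier (\<lambda>k. c * \<mu> k)"
proof -
  have "diag_poly (\<lambda>k. c * \<mu> k) q = smult c (diag_poly \<mu> q)" for q
    by (rule poly_eqI) simp
  moreover have "cpoly (smult c p) = smult (of_real c) (cpoly p)" for p
    by (rule poly_eqI) (simp add: coeff_map_poly)
  ultimately show ?thesis using assms by (auto simp: multiplier_def upper_nonvanishing_def)
qed

text \<open>In the factorization of \<open>P\<close> over its roots every factor
  \<open>a - y\<close> has modulus at least \<delta>. The bound involves only the leading
  coefficient and the degree, so it survives a passage to the limit.\<close>

lemma norm_poly_ge:
  fixes P :: "complex poly"
  assumes "\<And>y. poly P y = 0 \<Longrightarrow> \<delta> \<le> norm (a - y)" "\<delta> \<ge> 0" "P \<noteq> 0"
  shows "norm (lead_coeff P) * \<delta> ^ degree P \<le> norm (poly P a)"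
  using assms
proof (induction "degree P" arbitrary: P)
  case 0
  then obtain c where "P = [:c:]" by (metis degree_eq_zeroE)
  then show ?case by simp
next
  case (Suc n)
  then obtain y where y: "poly P y = 0"
    using alg_closed_imp_poly_has_root[of P] by auto
  then obtain Q where P: "P = [:- y, 1:] * Q"
    by (metis dvdE poly_eq_0_iff_dvd)
  have "Q \<noteq> 0" using Suc.hyps P by auto
  then have deg: "degree P = Suc (degree Q)"
    unfolding P by (subst degree_mult_eq) auto
  have lead: "lead_coeff P = lead_coeff Q"
    unfolding P by (subst lead_coeff_mult) simp
  have "norm (lead_coeff Q) * \<delta> ^ degree Q \<le> norm (poly Q a)"
    using Suc.hyps deg by (intro Suc.hyps(1)) (use Suc.prems \<open>Q \<noteq> 0\<close> P in auto)
  then have "\<delta> * (norm (lead_coeff Q) * \<delta> ^ degree Q) \<le> norm (a - y) * norm (poly Q a)"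
    using Suc.prems y by (intro mult_mono) auto
  also have "\<dots> = norm (poly P a)"
    unfolding P by (simp add: norm_mult[symmetric] algebra_simps)
  finally show ?case unfolding lead unfolding deg power_Suc by (simp only: mult_ac)
qed

text \<open>Conjugation excludes the lower half plane as well, and nonnegative coefficients make
  \<open>Q\<close> positive on the positive axis.\<close>

lemma upper_nonvanishing_nonneg_coeffs_roots:
  assumes "upper_nonvanishing (cpoly Q)" "Q \<noteq> 0" "\<And>k. coeff Q k \<ge> 0" "poly (cpoly Q) x = 0"
  shows "x \<in> \<real> \<and> Re x \<le> 0"
proof -
  have "\<not> Im x > 0" using assms(1,4) by (auto simp only: upper_nonvanishing_def)
  moreover have "poly (cpoly Q) (cnj x) = 0"
  proof -
    have "map_poly cnj (cpoly Q) = cpoly Q" by (rule poly_eqI) (simp add: coeff_map_poly)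
    then show ?thesis using assms(4) poly_cnj[of "cpoly Q" x] by simp
  qed
  then have "\<not> Im (cnj x) > 0" using assms(1) by (auto simp only: upper_nonvanishing_def)
  ultimately have "Im x = 0" by simp
  then have x: "x = of_real (Re x)" by (simp add: complex_eq_iff)
  then have "poly Q (Re x) = 0" using assms(4) by (metis poly_map_poly_of_real of_real_eq_0_iff)
  moreover have "poly Q t > 0" if "t > 0" for t
  proof -
    have "0 < coeff Q (degree Q) * t ^ degree Q"
      using assms(2) assms(3)[of "degree Q"] that by (intro mult_pos_pos order_le_neq_trans) auto
    also have "\<dots> \<le> (\<Sum>i\<le>degree Q. coeff Q i * t ^ i)"
      by (rule member_le_sum) (use assms(3) that in auto)
    finally show ?thesis by (simp add: poly_altdef)
  qed
  ultimately show ?thesis using x by (metis Reals_of_real less_irrefl not_le)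
qed

lemma poly_diag_poly_ffval: "poly (cpoly (diag_poly (ffval f) q)) x = poly (par_op x f (cpoly q)) x"
proof -
  have "poly (cpoly (diag_poly (ffval f) (\<Sum>i\<in>A. monom (c i) i))) x =
      poly (par_op x f (cpoly (\<Sum>i\<in>A. monom (c i) i))) x" if "finite A" for A c
    using that
  proof (induction A rule: finite_induct)
    case empty
    have "diag_poly (ffval f) 0 = 0" by (rule poly_eqI) simp
    then show ?case by simp
  next
    case (insert i A)
    then show ?case
      by (simp add: diag_poly_add map_poly_of_real_add par_op_add diag_poly_monom map_poly_monom
          poly_par_op_monom poly_monom)
  qed
  from this[of "{..degree q}" "coeff q"] show ?thesis
    by (simp add: poly_as_sum_of_monoms)
qed

lemma higher_pderiv_one_plus_power:
  "(pderiv ^^ m) ([:1, 1:] ^ N) = smult (of_real (falling m N)) ([:1, 1:] ^ (N - m) :: complex poly)"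
proof (induction m)
  case (Suc m)
  have "pderiv ([:1, 1:] ^ n) = smult (of_nat n) ([:1, 1:] ^ (n - 1) :: complex poly)" for n
    by (cases n) (simp_all add: pderiv_power_Suc pderiv_pCons del: power_Suc)
  with Suc show ?case
    by (simp add: pderiv_smult falling_Suc mult_ac)
qed simp

text \<open>Derivatives of \<open>(1 + x)^N\<close> are multiples of powers of \<open>1 + x\<close>;
  extracting \<open>(1 + x)^N\<close> leaves a polynomial in \<open>x / (1 + x)\<close>. The bound
  on \<open>N\<close> prevents truncation in \<open>N - m\<close>.\<close>

lemma poly_diag_one_plus_power:
  assumes "1 + x \<noteq> 0" "degree f \<le> N"
  shows "poly (cpoly (diag_poly (ffval f) ([:1, 1:] ^ N))) x =
    (1 + x) ^ N * (\<Sum>m\<le>degree f. of_real (coeff f m * falling m N) * (x / (1 + x)) ^ m)"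
proof -
  have "cpoly ([:1, 1:] ^ N) = [:1, 1:] ^ N"
    by (induction N) (simp_all add: map_poly_of_real_mult map_poly_pCons del: mult_pCons_left)
  then have "poly (cpoly (diag_poly (ffval f) ([:1, 1:] ^ N))) x =
      (\<Sum>m\<le>degree f. of_real (coeff f m) * x ^ m * (of_real (falling m N) * (1 + x) ^ (N - m)))"
    by (simp add: poly_diag_poly_ffval par_op_def poly_sum higher_pderiv_one_plus_power mult.assoc)
  also have "\<dots> = (\<Sum>m\<le>degree f. (1 + x) ^ N * (of_real (coeff f m * falling m N) * (x / (1 + x)) ^ m))"
  proof (rule sum.cong[OF refl])
    fix m assume "m \<in> {..degree f}"
    then have "(1 + x) ^ (N - m) = (1 + x) ^ N / (1 + x) ^ m"
      using assms by (intro power_diff) auto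
    then show "of_real (coeff f m) * x ^ m * (of_real (falling m N) * (1 + x) ^ (N - m)) =
        (1 + x) ^ N * (of_real (coeff f m * falling m N) * (x / (1 + x)) ^ m)"
      by (simp add: power_divide)
  qed
  finally show ?thesis by (simp add: sum_distrib_left)
qed

lemma falling_over_power_tendsto: "(\<lambda>N. falling m N / real N ^ m) \<longlonglongrightarrow> 1"
proof (induction m)
  case (Suc m)
  have "(\<lambda>N. (real N - real m) / real N) \<longlonglongrightarrow> 1" by real_asymp
  then have "(\<lambda>N. real (N - m) / real N) \<longlonglongrightarrow> 1"
    by (rule Lim_transform_eventually) (auto intro!: eventually_mono[OF eventually_ge_at_top[of m]])
  from tendsto_mult[OF this Suc] show ?case by (simp add: falling_Suc)
qed simp

text \<open>\<open>T(1 + x)\<^sup>N = (1 + x)\<^sup>N G(N x / (1 + x))\<close>, where the coefficients of \<open>G\<close> converge to those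
  of \<open>f\<close> as \<open>N\<close> tends to infinity.  The zeros of \<open>T(1 + x)\<^sup>N\<close> are real and nonpositive, so those
  of \<open>G\<close> lie in \<open>(-\<infinity>, 0] \<union> [N, \<infinity>)\<close>.\<close>

lemma nonneg_multiplier_symbol_zeros:
  assumes mult: "multiplier (ffval f)" and "f \<noteq> 0" and nonneg: "\<And>k. ffval f k \<ge> 0"
  shows "only_real_nonpos_zeros f"
  unfolding only_real_nonpos_zeros_def
proof (rule conjI[OF \<open>f \<noteq> 0\<close>], intro allI impI)
  fix a :: complex assume a: "poly (map_poly of_real f) a = 0"
  show "a \<in> \<real> \<and> Re a \<le> 0"
  proof (rule ccontr)
    assume *: "\<not> (a \<in> \<real> \<and> Re a \<le> 0)"
    \<comment> \<open>A lower bound for the distance from \<open>a\<close> to the nonpositive half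
      line, positive because \<open>a\<close> lies off it.\<close>
    define \<delta> where "\<delta> = (if Im a = 0 then Re a else \<bar>Im a\<bar>)"
    have "\<delta> > 0" using * by (auto simp: \<delta>_def complex_is_Real_iff)
    have dist0: "\<delta> \<le> norm (a - y)" if "y \<in> \<real>" "Re y \<le> 0" for y
    proof (cases "Im a = 0")
      case True
      have "\<delta> \<le> Re (a - y)" using True that by (simp add: \<delta>_def)
      also have "\<dots> \<le> norm (a - y)" by (rule complex_Re_le_cmod)
      finally show ?thesis .
    next
      case False
      have "\<delta> = \<bar>Im (a - y)\<bar>" using False that by (simp add: \<delta>_def complex_is_Real_iff)
      also have "\<dots> \<le> norm (a - y)" by (rule abs_Im_le_cmod)
      finally show ?thesis .
    qed
    let ?d = "degree f"
    \<comment> \<open>Rescaling the argument by \<open>N\<close> normalizes the falling factorials,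
      so that the coefficients converge to those of \<open>f\<close>.\<close>
    define b where "b = (\<lambda>N m. coeff f m * (falling m N / real N ^ m))"
    define G where "G = (\<lambda>N. \<Sum>m\<le>?d. monom (complex_of_real (b N m)) m)"
    have poly_G: "poly (G N) y = (\<Sum>m\<le>?d. of_real (b N m) * y ^ m)" for N y
      by (simp add: G_def poly_sum poly_monom)
    have b_lim: "(\<lambda>N. b N m) \<longlonglongrightarrow> coeff f m" for m
      unfolding b_def using tendsto_mult[OF tendsto_const falling_over_power_tendsto] by simp
    obtain k0 where k0: "ffval f k0 \<noteq> 0" using ex_ffval_nonzero[OF \<open>f \<noteq> 0\<close>] by blast
    \<comment> \<open>The conditions on \<open>N\<close> ensure a nonzero top coefficient and a
      nonzero image, and keep zeros in \<open>[N, \<infinity>)\<close> at distance at least \<delta>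
      from \<open>a\<close>.\<close>
    have bound: "\<bar>b N ?d\<bar> * \<delta> ^ ?d \<le> norm (poly (G N) a)"
      if N: "N \<ge> k0" "N \<ge> ?d" "N \<ge> 1" "real N \<ge> norm a + \<delta>" for N
    proof -
      have "b N ?d \<noteq> 0" using \<open>f \<noteq> 0\<close> N by (auto simp: b_def falling_eq_0_iff)
      have coeff_G: "coeff (G N) m = (if m \<le> ?d then of_real (b N m) else 0)" for m
        by (simp add: G_def coeff_sum)
      then have deg: "degree (G N) = ?d"
        using \<open>b N ?d \<noteq> 0\<close> by (intro antisym degree_le le_degree) auto
      let ?Q = "diag_poly (ffval f) ([:1, 1:] ^ N)"
      have cQ: "coeff ?Q N = ffval f N" by (simp add: coeff_linear_power)
      have "ffval f N \<noteq> 0"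
        using multiplier_nonzero_mono[OF mult poly_seq_ffval k0] N by simp
      then have "?Q \<noteq> 0" using cQ by (metis coeff_0)
      have "upper_nonvanishing (cpoly ?Q)"
        using mult \<open>?Q \<noteq> 0\<close> upper_nonvanishing_one_plus_power[of N] by (auto simp: multiplier_def)
      moreover have "coeff ([:1, 1:] ^ n :: real poly) k \<ge> 0" for n k
        by (induction n arbitrary: k) (auto simp: coeff_pCons split: nat.splits)
      then have "coeff ?Q k \<ge> 0" for k using nonneg by simp
      ultimately have roots_Q: "x \<in> \<real> \<and> Re x \<le> 0" if "poly (cpoly ?Q) x = 0" for x
        using \<open>?Q \<noteq> 0\<close> that by (intro upper_nonvanishing_nonneg_coeffs_roots)
      have "\<delta> \<le> norm (a - y)" if y: "poly (G N) y = 0" for y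
      proof -
        \<comment> \<open>The substitution \<open>w = x / (1 + x)\<close> is inverted;
          \<open>w = 1\<close> has no preimage and corresponds to \<open>y = N\<close>.\<close>
        define w where "w = y / of_nat N"
        have yw: "y = of_nat N * w" using N by (simp add: w_def)
        have "y \<in> \<real> \<and> (Re y \<le> 0 \<or> Re y \<ge> real N)"
        proof (cases "w = 1")
          case False
          define x where "x = w / (1 - w)"
          have x1: "1 + x = 1 / (1 - w)" using False by (simp add: x_def field_simps)
          then have ne: "1 + x \<noteq> 0" using False by simp
          have wx: "x / (1 + x) = w" using False x1 by (simp add: x_def)
          have "poly (cpoly ?Q) x = (1 + x) ^ N * (\<Sum>m\<le>?d. of_real (coeff f m * falling m N) * w ^ m)"
            using poly_diag_one_plus_power[OF ne, of f N] N wx by simp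
          also have "(\<Sum>m\<le>?d. of_real (coeff f m * falling m N) * w ^ m) = poly (G N) y"
            unfolding poly_G yw by (rule sum.cong) (use N in \<open>simp_all add: b_def power_mult_distrib\<close>)
          finally have "poly (cpoly ?Q) x = 0" using y by simp
          then have x: "x \<in> \<real>" "Re x \<le> 0" using roots_Q by auto
          define t where "t = Re x"
          have xt: "x = of_real t" using x by (simp add: t_def)
          then have "of_real (1 + t) \<noteq> (0 :: complex)" using ne by simp
          then have t: "1 + t \<noteq> 0" by (metis of_real_0)
          have "w = of_real (t / (1 + t))" using wx xt by simp
          then have "y = of_real (real N * (t / (1 + t)))" using yw by simp
          \<comment> \<open>The quotient is nonpositive for \<open>- 1 < t \<le> 0\<close> and
            exceeds 1 for \<open>t < - 1\<close>.\<close>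
          moreover have "t / (1 + t) \<le> 0 \<or> t / (1 + t) \<ge> 1"
            using x t by (auto simp: t_def[symmetric] divide_simps)
          then have "real N * (t / (1 + t)) \<le> 0 \<or> real N * (t / (1 + t)) \<ge> real N"
            by (metis mult_left_mono mult_nonneg_nonpos of_nat_0_le_iff mult.right_neutral)
          ultimately show ?thesis by simp
        qed (simp add: yw)
        then show ?thesis
        proof (elim conjE disjE)
          assume "Re y \<ge> real N"
          then have "norm a + \<delta> \<le> norm y" using N complex_Re_le_cmod[of y] by linarith
          then show ?thesis using norm_triangle_ineq3[of a y] by linarith
        qed (use dist0 in auto)
      qed
      then have "norm (lead_coeff (G N)) * \<delta> ^ degree (G N) \<le> norm (poly (G N) a)"
        using \<open>\<delta> > 0\<close> \<open>b N ?d \<noteq> 0\<close> coeff_G[of ?d] by (intro norm_poly_ge) auto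
      then show ?thesis by (simp add: deg coeff_G)
    qed
    have "(\<lambda>N. norm (poly (G N) a)) \<longlonglongrightarrow> norm (\<Sum>m\<le>?d. of_real (coeff f m) * a ^ m)"
      unfolding poly_G by (intro tendsto_intros b_lim)
    also have "(\<Sum>m\<le>?d. of_real (coeff f m) * a ^ m) = 0"
      using a by (simp add: poly_altdef coeff_map_poly)
    finally have lim0: "(\<lambda>N. norm (poly (G N) a)) \<longlonglongrightarrow> norm (0 :: complex)" .
    have lim1: "(\<lambda>N. \<bar>b N ?d\<bar> * \<delta> ^ ?d) \<longlonglongrightarrow> \<bar>coeff f ?d\<bar> * \<delta> ^ ?d"
      by (intro tendsto_intros b_lim)
    have "eventually (\<lambda>N. N \<ge> k0 \<and> N \<ge> ?d \<and> N \<ge> 1 \<and> real N \<ge> norm a + \<delta>) sequentially"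
      by (intro eventually_conj eventually_ge_at_top eventually_compose_filterlim[OF _ filterlim_real_sequentially])
    then have "eventually (\<lambda>N. \<bar>b N ?d\<bar> * \<delta> ^ ?d \<le> norm (poly (G N) a)) sequentially"
      by eventually_elim (use bound in auto)
    \<comment> \<open>The lower bound keeps a positive limit while the upper one tends to 0, as
      \<open>f\<close> vanishes at \<open>a\<close>.\<close>
    from tendsto_le[OF _ lim0 lim1 this] have "\<bar>coeff f ?d\<bar> * \<delta> ^ ?d \<le> 0" by simp
    moreover have "\<bar>coeff f ?d\<bar> * \<delta> ^ ?d > 0" using \<open>\<delta> > 0\<close> \<open>f \<noteq> 0\<close> by simp
    ultimately show False by linarith
  qed
qed

lemma ffval_smult: "ffval (smult c f) k = c * ffval f k"
  by (cases "c = 0") (simp_all add: ffval_def sum_distrib_left mult_ac)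

lemma only_real_nonpos_zeros_smult:
  assumes "only_real_nonpos_zeros f" "c \<noteq> 0"
  shows "only_real_nonpos_zeros (smult c f)"
proof -
  have "cpoly (smult c f) = smult (of_real c) (cpoly f)"
    by (rule poly_eqI) (simp add: coeff_map_poly)
  then show ?thesis using assms by (auto simp: only_real_nonpos_zeros_def)
qed

text \<open>By \<open>multiplier_sign\<close> the sequence or its negative is nonnegative, and
  changing the sign of the symbol does not move its zeros.\<close>

lemma multiplier_symbol_zeros:
  assumes mult: "multiplier (ffval f)" and "f \<noteq> 0"
  shows "only_real_nonpos_zeros f"
proof -
  obtain s where s: "s = 1 \<or> s = - 1" "\<And>k. s * ffval f k \<ge> 0"
    using multiplier_sign[OF mult poly_seq_ffval] by blast
  have "s \<noteq> 0" using s by auto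
  have "ffval (smult s f) = (\<lambda>k. s * ffval f k)" by (auto simp: ffval_smult)
  then have "only_real_nonpos_zeros (smult s f)"
    using s \<open>f \<noteq> 0\<close> \<open>s \<noteq> 0\<close> multiplier_cmult[OF mult \<open>s \<noteq> 0\<close>]
    by (intro nonneg_multiplier_symbol_zeros) auto
  from only_real_nonpos_zeros_smult[OF this, of "1 / s"] \<open>s \<noteq> 0\<close> show ?thesis by simp
qed


section \<open>Factorization of the eigenvalues\<close>

lemma ffval_add: "ffval (f + g) k = ffval f k + ffval g k"
proof -
  let ?N = "max (degree f) (degree g)"
  have "ffval (f + g) k = (\<Sum>m\<le>?N. coeff (f + g) m * falling m k)"
    by (rule ffval_bound) (rule degree_add_le_max)
  then show ?thesis
    by (simp add: ffval_bound[of f ?N] ffval_bound[of g ?N] distrib_right sum.distrib)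
qed

lemma ffval_0 [simp]: "ffval 0 k = 0"
  by (simp add: ffval_def)

lemma ffval_sum: "ffval (\<Sum>x\<in>A. f x) k = (\<Sum>x\<in>A. ffval (f x) k)"
  by (induction A rule: infinite_finite_induct) (auto simp: ffval_add)

lemma ffval_monom: "ffval (monom c m) k = c * falling m k"
proof -
  have "ffval (monom c m) k = (\<Sum>j\<le>m. coeff (monom c m) j * falling j k)"
    by (rule ffval_bound) (rule degree_monom_le)
  also have "\<dots> = (\<Sum>j\<le>m. if j = m then c * falling m k else 0)"
    by (rule sum.cong) auto
  finally show ?thesis by simp
qed

text \<open>With the other coordinates frozen at \<open>a\<close> their falling factorials are
  constants, and what remains is the eigenvalue of a univariate symbol.\<close>

lemma diff_op_line_ffval:
  fixes l :: "'n::finite midx \<Rightarrow> real"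
  assumes "diagonal_op l = diff_op F"
  shows "\<exists>f. \<forall>\<alpha>. (\<forall>j. j \<noteq> i \<longrightarrow> lookup \<alpha> j = a j) \<longrightarrow> l \<alpha> = ffval f (lookup \<alpha> i)"
proof (intro exI allI impI)
  define c where "c = (\<lambda>\<gamma>. if \<forall>i. lookup \<gamma> (Inl i) = lookup \<gamma> (Inr i)
     then lookup F \<gamma> * (\<Prod>j\<in>UNIV - {i}. falling (lookup \<gamma> (Inr j)) (a j)) else 0)"
  fix \<alpha> :: "'n midx" assume \<alpha>: "\<forall>j. j \<noteq> i \<longrightarrow> lookup \<alpha> j = a j"
  have "l \<alpha> = (\<Sum>\<gamma>\<in>keys F. c \<gamma> * falling (lookup \<gamma> (Inr i)) (lookup \<alpha> i))"
    unfolding diagonal_diff_op_coeff[OF assms]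
  proof (rule sum.cong[OF refl])
    fix \<gamma> :: "('n + 'n) midx"
    have "(\<Prod>j\<in>UNIV. falling (lookup \<gamma> (Inr j)) (lookup \<alpha> j)) =
        falling (lookup \<gamma> (Inr i)) (lookup \<alpha> i) * (\<Prod>j\<in>UNIV - {i}. falling (lookup \<gamma> (Inr j)) (lookup \<alpha> j))"
      by (rule prod.remove) auto
    also have "(\<Prod>j\<in>UNIV - {i}. falling (lookup \<gamma> (Inr j)) (lookup \<alpha> j)) =
        (\<Prod>j\<in>UNIV - {i}. falling (lookup \<gamma> (Inr j)) (a j))"
      by (rule prod.cong) (use \<alpha> in auto)
    finally show "(if \<forall>i. lookup \<gamma> (Inl i) = lookup \<gamma> (Inr i)
        then lookup F \<gamma> * (\<Prod>j\<in>UNIV. falling (lookup \<gamma> (Inr j)) (lookup \<alpha> j)) else 0) =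
        c \<gamma> * falling (lookup \<gamma> (Inr i)) (lookup \<alpha> i)"
      by (simp add: c_def)
  qed
  then show "l \<alpha> = ffval (\<Sum>\<gamma>\<in>keys F. monom (c \<gamma>) (lookup \<gamma> (Inr i))) (lookup \<alpha> i)"
    by (simp add: ffval_sum ffval_monom)
qed

section \<open>Stable test polynomials\<close>

lemma monomial_upper_nonzero:
  fixes z :: "'n::finite \<Rightarrow> complex"
  assumes "\<And>j. Im (z j) > 0"
  shows "(\<Prod>j\<in>UNIV. z j ^ lookup \<alpha> j) \<noteq> 0"
  using assms
  by (metis (no_types, lifting) finite less_irrefl power_not_zero prod_zero_iff zero_complex.simps(2))

text \<open>The polynomial \<open>z^\<alpha> q(z_i)\<close>, which carries univariate tests over to
  several variables.\<close>

definition line_poly :: "'n midx \<Rightarrow> 'n \<Rightarrow> real poly \<Rightarrow> 'n mpoly"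
  where "line_poly \<alpha> i q = (\<Sum>k\<le>degree q. single (\<alpha> + single i k) (coeff q k))"

lemma lookup_line_poly: "lookup (line_poly \<alpha> i q) (\<alpha> + single i k) = coeff q k"
proof -
  have "single i m = single i k \<longleftrightarrow> m = k" for m :: nat
    by (metis lookup_single_eq)
  then show ?thesis
    by (cases "k \<le> degree q") (simp_all add: line_poly_def lookup_sum lookup_single when_def coeff_eq_0)
qed

lemma meval_line_poly:
  "meval (line_poly \<alpha> i q) z = (\<Prod>j\<in>UNIV. z j ^ lookup \<alpha> j) * poly (cpoly q) (z i)"
  by (simp add: line_poly_def meval_sum meval_single prod_power_add_single poly_altdef
      coeff_map_poly sum_distrib_left mult_ac)

lemma diagonal_op_line_poly:
  "diagonal_op l (line_poly \<alpha> i q) = line_poly \<alpha> i (diag_poly (\<lambda>k. l (\<alpha> + single i k)) q)"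
proof -
  let ?D = "diag_poly (\<lambda>k. l (\<alpha> + single i k)) q"
  have "degree ?D \<le> degree q" by (rule degree_le) (simp add: coeff_eq_0)
  then have "line_poly \<alpha> i ?D = (\<Sum>k\<le>degree q. single (\<alpha> + single i k) (coeff ?D k))"
    unfolding line_poly_def
    by (intro sum.mono_neutral_left) (auto simp: coeff_eq_0 not_le simp del: coeff_diag_poly)
  moreover have "diagonal_op l (\<Sum>x\<in>A. p x) = (\<Sum>x\<in>A. diagonal_op l (p x))" for A :: "nat set" and p
    by (induction A rule: infinite_finite_induct) (auto simp: diagonal_op_add)
  ultimately show ?thesis
    by (simp add: line_poly_def diagonal_op_single)
qed

text \<open>The factor \<open>z^\<alpha>\<close> of \<open>line_poly\<close> has no zero on the
  product of upper half planes, so stability of the test polynomial and of its image is decided by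
  the univariate factor.\<close>

lemma multiplier_line:
  fixes l :: "'n::finite midx \<Rightarrow> real"
  assumes pres: "\<And>p. real_stable p \<Longrightarrow> diagonal_op l p = 0 \<or> real_stable (diagonal_op l p)"
  shows "multiplier (\<lambda>k. l (\<alpha> + single i k))"
  unfolding multiplier_def
proof (intro allI impI)
  fix q assume q: "upper_nonvanishing (cpoly q)"
  let ?D = "diag_poly (\<lambda>k. l (\<alpha> + single i k)) q"
  have "real_stable (line_poly \<alpha> i q)"
    using q monomial_upper_nonzero[of _ \<alpha>]
    unfolding real_stable_def meval_line_poly upper_nonvanishing_def mult_eq_0_iff by blast
  then consider "line_poly \<alpha> i ?D = 0" | "real_stable (line_poly \<alpha> i ?D)"
    using pres[of "line_poly \<alpha> i q"] by (auto simp: diagonal_op_line_poly)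
  then show "?D = 0 \<or> upper_nonvanishing (cpoly ?D)"
  proof cases
    case 1
    then have "coeff ?D k = 0" for k using lookup_line_poly[of \<alpha> i ?D k] by simp
    then show ?thesis by (simp add: poly_eq_iff)
  next
    case 2
    have "poly (cpoly ?D) u \<noteq> 0" if "Im u > 0" for u
      using 2 that unfolding real_stable_def meval_line_poly by (auto dest: spec[of _ "\<lambda>_. u"])
    then show ?thesis by (simp add: upper_nonvanishing_def)
  qed
qed

text \<open>Put \<open>x = \<i>\<close> and solve for \<open>y\<close>: its imaginary part is
  \<open>(A D - B C) / (C^2 + D^2)\<close>, positive if the inequality fails.\<close>

lemma bilinear_nonvanishing:
  fixes A B C D :: real
  assumes "\<And>(x::complex) (y::complex). Im x > 0 \<Longrightarrow> Im y > 0 \<Longrightarrow> A + B * x + C * y + D * x * y \<noteq> 0"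
  shows "A * D \<le> B * C"
proof (rule ccontr)
  assume neg: "\<not> A * D \<le> B * C"
  then have "C \<noteq> 0 \<or> D \<noteq> 0" by auto
  then have pos: "C\<^sup>2 + D\<^sup>2 > 0" by (simp add: sum_power2_gt_zero_iff)
  define den where "den = of_real C + of_real D * \<i>"
  define y where "y = - (of_real A + of_real B * \<i>) / den"
  have "den \<noteq> 0" using \<open>C \<noteq> 0 \<or> D \<noteq> 0\<close> by (auto simp: den_def complex_eq_iff)
  then have "den * y = - (of_real A + of_real B * \<i>)" by (simp add: y_def)
  then have "of_real A + of_real B * \<i> + of_real C * y + of_real D * \<i> * y = 0"
    by (simp add: den_def algebra_simps add_eq_0_iff)
  moreover have "Im y = (A * D - B * C) / (C\<^sup>2 + D\<^sup>2)"
    by (simp add: y_def den_def Im_divide algebra_simps)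
  then have "Im y > 0" using neg pos by simp
  ultimately show False using assms[where x = "\<i>" and y = y] by simp
qed

text \<open>Apply the operator to \<open>z\<^sup>\<alpha> (1 + s z\<^sub>i)(1 + z\<^sub>j)\<close>; the two signs \<open>s\<close> give opposite inequalities.\<close>

lemma stability_preserver_exchange:
  fixes l :: "'n::finite midx \<Rightarrow> real"
  assumes pres: "\<And>p. real_stable p \<Longrightarrow> diagonal_op l p = 0 \<or> real_stable (diagonal_op l p)"
    and "i \<noteq> j"
  shows "l \<alpha> * l (\<alpha> + single i 1 + single j 1) = l (\<alpha> + single i 1) * l (\<alpha> + single j 1)"
proof -
  let ?A = "l \<alpha>" and ?B = "l (\<alpha> + single i 1)" and ?C = "l (\<alpha> + single j 1)"
    and ?D = "l (\<alpha> + single i 1 + single j 1)"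
  have le: "?A * (s * ?D) \<le> s * ?B * ?C" if s: "s = 1 \<or> s = - 1" for s :: real
  proof -
    define p where "p = single \<alpha> 1 + single (\<alpha> + single i 1) s + single (\<alpha> + single j 1) 1
       + single (\<alpha> + single i 1 + single j 1) s"
    have Tp: "diagonal_op l p = single \<alpha> ?A + single (\<alpha> + single i 1) (s * ?B) +
        single (\<alpha> + single j 1) ?C + single (\<alpha> + single i 1 + single j 1) (s * ?D)"
      by (simp add: p_def diagonal_op_add diagonal_op_single mult.commute)
    have "meval p z = (\<Prod>k\<in>UNIV. z k ^ lookup \<alpha> k) * ((1 + of_real s * z i) * (1 + z j))" for z
      by (simp add: p_def meval_add meval_single prod_power_add_single, simp add: algebra_simps)
    moreover have "1 + of_real s * u \<noteq> 0" "1 + u \<noteq> 0" if "Im u > 0" for u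
    proof -
      have "Im (1 + of_real s * u) \<noteq> 0" "Im (1 + u) \<noteq> 0" using that s by auto
      then show "1 + of_real s * u \<noteq> 0" "1 + u \<noteq> 0" by (metis zero_complex.simps(2))+
    qed
    ultimately have "meval p z \<noteq> 0" if "\<And>k. Im (z k) > 0" for z
      using monomial_upper_nonzero[OF that] that by (simp only: mult_eq_0_iff simp_thms)
    then have "real_stable p" by (simp add: real_stable_def)
    then consider "diagonal_op l p = 0" | "real_stable (diagonal_op l p)" using pres by blast
    then show ?thesis
    proof cases
      case 1
      have ne: "single i 1 \<noteq> (0 :: 'n midx)" "single j 1 \<noteq> (0 :: 'n midx)"
          "single i 1 + single j 1 \<noteq> (0 :: 'n midx)" "single i 1 \<noteq> (single j 1 :: 'n midx)"
        using \<open>i \<noteq> j\<close> by (auto simp: poly_mapping_eq_iff fun_eq_iff lookup_add lookup_single when_def)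
      \<comment> \<open>A vanishing image forces \<open>?A\<close> and \<open>?B\<close> to be zero,
        because \<open>p\<close> has nonzero coefficients there.\<close>
      have "lookup p \<alpha> = 1" "lookup p (\<alpha> + single i 1) = s"
        using ne by (auto simp: p_def lookup_add lookup_single when_def add.assoc)
      moreover have "l \<alpha> * lookup p \<alpha> = 0" "?B * lookup p (\<alpha> + single i 1) = 0"
        using 1 by (metis lookup_diagonal_op lookup_zero)+
      ultimately show ?thesis using s by auto
    next
      case 2
      show ?thesis
      proof (rule bilinear_nonvanishing)
        fix x y :: complex assume "Im x > 0" "Im y > 0"
        define z where "z = (\<lambda>k. if k = i then x else y)"
        have z: "Im (z k) > 0" for k using \<open>Im x > 0\<close> \<open>Im y > 0\<close> by (simp add: z_def)
        have "meval (diagonal_op l p) z = (\<Prod>k\<in>UNIV. z k ^ lookup \<alpha> k) *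
            (?A + (s * ?B) * z i + ?C * z j + (s * ?D) * z i * z j)"
          unfolding Tp by (simp add: meval_add meval_single prod_power_add_single, simp add: algebra_simps)
        moreover have "meval (diagonal_op l p) z \<noteq> 0" using 2 z by (simp add: real_stable_def)
        ultimately show "?A + (s * ?B) * x + ?C * y + (s * ?D) * x * y \<noteq> (0 :: complex)"
          using \<open>i \<noteq> j\<close> by (simp add: z_def)
      qed
    qed
  qed
  from le[of 1] le[of "- 1"] show ?thesis by simp
qed

section \<open>From local exchange to a product formula\<close>

lemma grid_rank_one:
  fixes g :: "nat \<Rightarrow> nat \<Rightarrow> real"
  assumes nz: "\<And>k m. g k m \<noteq> 0"
    and ex: "\<And>k m. g k m * g (Suc k) (Suc m) = g (Suc k) m * g k (Suc m)"
  shows "g 0 0 * g k m = g k 0 * g 0 m"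
proof -
  \<comment> \<open>Adjacent two by two minors vanish, so the ratio of consecutive rows does not
    depend on the column.\<close>
  have row: "g (Suc k) m / g k m = g (Suc k) 0 / g k 0" for k m
  proof (induction m)
    case (Suc m)
    have "g (Suc k) (Suc m) / g k (Suc m) = g (Suc k) m / g k m"
      using ex[of k m] nz by (simp add: frac_eq_eq mult_ac)
    with Suc show ?case by simp
  qed simp
  have "g k m / g k 0 = g 0 m / g 0 0"
  proof (induction k)
    case (Suc k)
    have "g (Suc k) m / g (Suc k) 0 = g k m / g k 0"
      using row[of k m] nz by (simp add: frac_eq_eq mult_ac)
    with Suc show ?case by simp
  qed simp
  then show ?thesis using nz by (simp add: frac_eq_eq mult_ac)
qed

text \<open>The lower bounds are dropped one coordinate at a time: in that coordinate
  \<open>h\<close> is polynomial and vanishes from some point on.\<close>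

lemma separately_poly_seq_eq_0:
  fixes h :: "('n::finite \<Rightarrow> nat) \<Rightarrow> real"
  assumes sep: "\<And>a i. poly_seq (\<lambda>k. h (a(i := k)))"
    and zero: "\<And>a. (\<And>i. \<gamma> i \<le> a i) \<Longrightarrow> h a = 0"
  shows "h a = 0"
proof -
  have "(\<And>i. i \<notin> S \<Longrightarrow> \<gamma> i \<le> a i) \<Longrightarrow> h a = 0" if "finite S" for S a
    using that
  proof (induction S arbitrary: a rule: finite_induct)
    case (insert j S)
    have "h (a(j := k)) = 0" for k
    proof (rule poly_seq_eq_0[OF sep])
      fix m assume "\<gamma> j \<le> m"
      then show "h (a(j := m)) = 0" using insert by (intro insert.IH) auto
    qed
    from this[of "a j"] show ?case by simp
  qed (use zero in auto)
  from this[of UNIV] show ?thesis by simp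
qed

lemma stability_preserver_factorization:
  fixes L :: "('n::finite \<Rightarrow> nat) \<Rightarrow> real"
  assumes mult: "\<And>a i. multiplier (\<lambda>k. L (a(i := a i + k)))"
    and seq: "\<And>a i. poly_seq (\<lambda>k. L (a(i := k)))"
    and ex: "\<And>a i j. i \<noteq> j \<Longrightarrow>
      L a * L (a(i := Suc (a i), j := Suc (a j))) = L (a(i := Suc (a i))) * L (a(j := Suc (a j)))"
    and \<gamma>: "L \<gamma> \<noteq> 0"
  shows "L a = L \<gamma> * (\<Prod>i\<in>UNIV. L (\<gamma>(i := a i)) / L \<gamma>)"
proof -
  \<comment> \<open>Intermediate points on a path from \<gamma> to \<open>a\<close> that changes one
    coordinate at a time; the inductions over \<open>S\<close> follow it.\<close>
  define mix where "mix = (\<lambda>S (a :: 'n \<Rightarrow> nat) i. if i \<in> S then a i else \<gamma> i)"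
  have nz: "L b \<noteq> 0" if b: "\<And>i. \<gamma> i \<le> b i" for b
  proof -
    have "L (mix S b) \<noteq> 0" if "finite S" for S
      using that
    proof (induction S rule: finite_induct)
      case empty
      then show ?case using \<gamma> by (simp add: mix_def)
    next
      case (insert j S)
      let ?c = "mix S b"
      have c: "?c j = \<gamma> j" using insert by (simp add: mix_def)
      have "L (?c(j := ?c j + (b j - \<gamma> j))) \<noteq> 0"
        by (rule multiplier_nonzero_mono[OF mult poly_seq_shift[OF seq], of _ _ 0]) (use insert in auto)
      moreover have "?c(j := ?c j + (b j - \<gamma> j)) = mix (insert j S) b"
        using b[of j] c by (auto simp: mix_def fun_eq_iff)
      ultimately show ?case by simp
    qed
    from this[of UNIV] show ?thesis by (simp add: mix_def)
  qed
  \<comment> \<open>Unit exchange steps combine to steps of any length, by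
    \<open>grid_rank_one\<close> on a coordinate plane where all values are nonzero.\<close>
  have exch: "L b * L (b(i := x, j := y)) = L (b(i := x)) * L (b(j := y))"
    if "i \<noteq> j" "\<And>k. \<gamma> k \<le> b k" "b i \<le> x" "b j \<le> y" for b i j x y
  proof -
    define g where "g = (\<lambda>k m. L (b(i := b i + k, j := b j + m)))"
    have "g 0 0 * g (x - b i) (y - b j) = g (x - b i) 0 * g 0 (y - b j)"
    proof (rule grid_rank_one)
      fix k m
      show "g k m \<noteq> 0" unfolding g_def by (rule nz) (use that in \<open>auto simp: trans_le_add1\<close>)
      show "g k m * g (Suc k) (Suc m) = g (Suc k) m * g k (Suc m)"
        using ex[OF \<open>i \<noteq> j\<close>, of "b(i := b i + k, j := b j + m)"] \<open>i \<noteq> j\<close>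
        by (simp add: g_def fun_upd_twist)
    qed
    moreover have "b(i := x, j := b j) = b(i := x)" using \<open>i \<noteq> j\<close> by auto
    ultimately show ?thesis using that by (simp add: g_def)
  qed
  \<comment> \<open>Changing coordinate \<open>j\<close> multiplies \<open>L\<close> by the same
    ratio at an intermediate point as at \<gamma>.\<close>
  have swap: "L ((mix S a)(j := a j)) * L \<gamma> = L (mix S a) * L (\<gamma>(j := a j))"
    if "finite S" "j \<notin> S" and a: "\<And>i. \<gamma> i \<le> a i" for S j a
    using that(1,2)
  proof (induction S rule: finite_induct)
    case empty
    then show ?case by (simp add: mix_def)
  next
    case (insert i S)
    let ?b = "mix S a"
    have b: "\<And>k. \<gamma> k \<le> ?b k" "?b i = \<gamma> i" "?b j = \<gamma> j" using a insert by (auto simp: mix_def)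
    have upd: "?b(i := a i) = mix (insert i S) a" by (auto simp: mix_def)
    have "L ?b * L (?b(i := a i, j := a j)) = L (?b(i := a i)) * L (?b(j := a j))"
      by (rule exch) (use insert b a in auto)
    then have "L ?b * (L ((mix (insert i S) a)(j := a j)) * L \<gamma>) =
        L (mix (insert i S) a) * (L (?b(j := a j)) * L \<gamma>)"
      by (simp only: upd mult_ac)
    also have "L (?b(j := a j)) * L \<gamma> = L ?b * L (\<gamma>(j := a j))"
      by (rule insert.IH) (use insert.prems in blast)
    finally have "L ?b * (L ((mix (insert i S) a)(j := a j)) * L \<gamma>) =
        L ?b * (L (mix (insert i S) a) * L (\<gamma>(j := a j)))" by (simp only: mult_ac)
    then show ?case by (rule mult_left_cancel[OF nz[OF b(1)], THEN iffD1])
  qed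
  have fact_ge: "L a = L \<gamma> * (\<Prod>i\<in>UNIV. L (\<gamma>(i := a i)) / L \<gamma>)" if a: "\<And>i. \<gamma> i \<le> a i" for a
  proof -
    have "L (mix S a) = L \<gamma> * (\<Prod>i\<in>S. L (\<gamma>(i := a i)) / L \<gamma>)" if "finite S" for S
      using that
    proof (induction S rule: finite_induct)
      case (insert j S)
      have "(mix S a)(j := a j) = mix (insert j S) a" by (auto simp: mix_def)
      then have "L (mix (insert j S) a) = L (mix S a) * (L (\<gamma>(j := a j)) / L \<gamma>)"
        using swap[OF insert.hyps a] \<gamma> by (simp add: field_simps)
      then show ?case by (simp only: insert.IH prod.insert[OF insert.hyps] mult_ac)
    qed (simp add: mix_def)
    from this[of UNIV] show ?thesis by (simp add: mix_def)
  qed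
  \<comment> \<open>Both sides are polynomial in each coordinate, so the identity extends from the
    orthant above \<gamma> to all arguments.\<close>
  define h where "h = (\<lambda>a. L a - L \<gamma> * (\<Prod>i\<in>UNIV. L (\<gamma>(i := a i)) / L \<gamma>))"
  have "h a = 0"
  proof (rule separately_poly_seq_eq_0)
    fix a i
    have eq: "(\<Prod>j\<in>UNIV. L (\<gamma>(j := (a(i := k)) j)) / L \<gamma>) =
        (\<Prod>j\<in>UNIV - {i}. L (\<gamma>(j := a j)) / L \<gamma>) / L \<gamma> * L (\<gamma>(i := k))" for k
      by (subst prod.remove[of _ i]) (auto intro!: prod.cong)
    show "poly_seq (\<lambda>k. h (a(i := k)))"
      unfolding h_def eq by (intro poly_seq_diff poly_seq_cmult seq)
  next
    fix a assume "\<And>i. \<gamma> i \<le> a i"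
    then show "h a = 0" using fact_ge[of a] by (simp add: h_def)
  qed
  then show ?thesis by (simp add: h_def)
qed

lemma stability_preserver_symbol:
  fixes l :: "'n::finite midx \<Rightarrow> real"
  assumes "diagonal_op l \<in> stability_preserving_diff_ops"
  shows "\<exists>f. (\<forall>i. only_real_nonpos_zeros (f i)) \<and> (\<forall>\<alpha>. l \<alpha> = (\<Prod>i\<in>UNIV. ffval (f i) (lookup \<alpha> i)))"
proof -
  have pres: "diagonal_op l p = 0 \<or> real_stable (diagonal_op l p)" if "real_stable p" for p
    using assms that by (auto simp: stability_preserving_diff_ops_def)
  obtain F where F: "diagonal_op l = diff_op F"
    using assms by (auto simp: stability_preserving_diff_ops_def diff_ops_def is_symbol_def)
  define mi :: "('n \<Rightarrow> nat) \<Rightarrow> 'n midx" where "mi = (\<lambda>a. \<Sum>i\<in>UNIV. single i (a i))"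
  have lookup_mi [simp]: "lookup (mi a) i = a i" for a i
    by (simp add: mi_def lookup_sum lookup_single when_def)
  have mi_lookup: "mi (lookup \<alpha>) = \<alpha>" for \<alpha>
    by (rule poly_mapping_eqI) simp
  have mi_upd: "mi (a(i := a i + k)) = mi a + single i k" for a i k
    by (rule poly_mapping_eqI) (simp add: lookup_add lookup_single when_def)
  define L where "L = (\<lambda>a. l (mi a))"
  have line: "\<exists>f. (\<lambda>k. L (a(i := k))) = ffval f" for a i
  proof -
    obtain f where f: "\<And>\<alpha>. (\<forall>j. j \<noteq> i \<longrightarrow> lookup \<alpha> j = a j) \<Longrightarrow> l \<alpha> = ffval f (lookup \<alpha> i)"
      using diff_op_line_ffval[OF F, of i a] by blast
    have "L (a(i := k)) = ffval f k" for k
      using f[of "mi (a(i := k))"] by (simp add: L_def)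
    then show ?thesis by blast
  qed
  have mult: "multiplier (\<lambda>k. L (a(i := a i + k)))" for a i
    unfolding L_def mi_upd by (rule multiplier_line[OF pres])
  have "\<exists>\<gamma>. L \<gamma> \<noteq> 0"
  proof (rule ccontr)
    assume "\<nexists>\<gamma>. L \<gamma> \<noteq> 0"
    then have "l \<alpha> = 0" for \<alpha> using mi_lookup[of \<alpha>] by (metis L_def)
    then have "diagonal_op l p = 0" for p
      by (intro poly_mapping_eqI) (simp add: lookup_diagonal_op)
    then show False using assms by (auto simp: stability_preserving_diff_ops_def)
  qed
  then obtain \<gamma> where \<gamma>: "L \<gamma> \<noteq> 0" by blast
  obtain f where f: "\<And>i. (\<lambda>k. L (\<gamma>(i := k))) = ffval (f i)"
    using line[of \<gamma>] by metis
  have f_zeros: "only_real_nonpos_zeros (f i)" for i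
  proof (rule multiplier_symbol_zeros)
    show "multiplier (ffval (f i))"
      \<comment> \<open>Starting the line at coordinate 0 gives the full sequence and not merely a
        tail.\<close>
      using mult[of "\<gamma>(i := 0)" i] by (simp add: f[symmetric])
    have "ffval (f i) (\<gamma> i) = L \<gamma>" by (simp add: f[symmetric])
    then show "f i \<noteq> 0" using \<gamma> by auto
  qed
  have L: "L a = L \<gamma> * (\<Prod>i\<in>UNIV. L (\<gamma>(i := a i)) / L \<gamma>)" for a
  proof (rule stability_preserver_factorization[OF mult _ _ \<gamma>])
    show "poly_seq (\<lambda>k. L (a(i := k)))" for a i
      using line[of a i] poly_seq_ffval by metis
    fix a :: "'n \<Rightarrow> nat" and i j :: 'n assume "i \<noteq> j"
    have "mi (a(i := Suc (a i), j := Suc (a j))) = mi a + single i 1 + single j 1"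
      by (rule poly_mapping_eqI) (use \<open>i \<noteq> j\<close> in \<open>auto simp: lookup_add lookup_single when_def\<close>)
    with stability_preserver_exchange[OF pres \<open>i \<noteq> j\<close>, of "mi a"] mi_upd[of a _ 1]
    show "L a * L (a(i := Suc (a i), j := Suc (a j))) = L (a(i := Suc (a i))) * L (a(j := Suc (a j)))"
      by (simp add: L_def)
  qed
  \<comment> \<open>Each factor is divided by \<open>L \<gamma>\<close>, and the leftover constant
    \<open>L \<gamma>\<close> is attached to a single coordinate; \<open>undefined\<close> serves as
    a name for some element of the index type.\<close>
  define c :: "'n \<Rightarrow> real" where "c = (\<lambda>i. (if i = undefined then L \<gamma> else 1) / L \<gamma>)"
  have "l \<alpha> = (\<Prod>i\<in>UNIV. ffval (smult (c i) (f i)) (lookup \<alpha> i))" for \<alpha>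
  proof -
    have "(\<Prod>i\<in>UNIV. ffval (smult (c i) (f i)) (lookup \<alpha> i)) =
        (\<Prod>i\<in>UNIV. (if i = undefined then L \<gamma> else 1) * (L (\<gamma>(i := lookup \<alpha> i)) / L \<gamma>))"
      by (rule prod.cong) (simp_all add: ffval_smult c_def f[symmetric])
    also have "\<dots> = L \<gamma> * (\<Prod>i\<in>UNIV. L (\<gamma>(i := lookup \<alpha> i)) / L \<gamma>)"
      by (simp only: prod.distrib prod.delta finite UNIV_I if_True)
    also have "\<dots> = L (lookup \<alpha>)" by (rule L[symmetric])
    finally show ?thesis by (simp add: L_def mi_lookup)
  qed
  moreover have "only_real_nonpos_zeros (smult (c i) (f i))" for i
    using f_zeros \<gamma> by (intro only_real_nonpos_zeros_smult) (auto simp: c_def)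
  ultimately show ?thesis by (intro exI[of _ "\<lambda>i. smult (c i) (f i)"]) auto
qed

theorem theorem1p9:
  fixes l :: "'n::finite midx \<Rightarrow> real"
  shows "diagonal_op l \<in> stability_preserving_diff_ops \<longleftrightarrow>
    (\<exists>f :: 'n \<Rightarrow> real poly.
       (\<forall>i. only_real_nonpos_zeros (f i)) \<and>
       is_symbol (diagonal_op l) (\<Prod>i\<in>UNIV. msubst (f i) (mvar (Inl i) * mvar (Inr i))))"
  using stability_preserver_symbol[of l] prod_symbol_preserves_stability[of _ l]
  by (auto simp: is_symbol_prod_msubst_iff)

end
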